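(* Let $m,b,k\in\mathbb{Z}$ with $|m|\ge 2$, $b\ge 2$, $k\ge 1$, and set $n=2$. Assume that $\gcd(b,m)=1$, that $b$ is squarefree, and that $m\equiv 0 \pmod{\mathrm{rad}(k)}$. Let $$\mathcal{D}:=\frac{n^n(1-bm^{2n})^{n+1}+bm^{2n}(n+1)^{n+1}}{(1+bm^{2n}n)^2}\in\mathbb{Z}\qquad (\text{with } n=2),$$ and assume that $$d:=\frac{|\mathcal{D}|}{\prod_{p\text{ prime},\ p\mid bm}p^{\nu_p(\mathcal{D})}}$$ is squarefree. Then the trinomial $$\mathcal{F}_{2,b,m,k}(x)=x^{2k}+bm^2x^k+b$$ is monogenic if and only if both of the following hold: (1) no odd prime divisor of $k$ is a base-$b$ Wieferich prime; and (2) if $m\equiv 0\pmod 2$, then $b\equiv 1\pmod 4$ (equivalently, $2$ is a base-$b$ Wieferich prime).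
   Context: For an integer $b\ge 2$, a prime $p\ge 2$ is called a base-$b$ Wieferich prime if $b^{p-1}\equiv 1\pmod{p^2}$. A monic polynomial $f(x)\in\mathbb{Z}[x]$ is called monogenic if $f(x)$ is irreducible over $\mathbb{Q}$ and $\{1,\theta,\theta^2,\ldots,\theta^{\deg(f)-1}\}$ is a basis (over $\mathbb{Z}$) for the ring of integers of $\mathbb{Q}(\theta)$, where $f(\theta)=0$. Here $\mathrm{rad}(1)=1$ and, for $k\ge 2$, $\mathrm{rad}(k)$ is the product of the distinct prime divisors of $k$; $\nu_p(z)$ denotes the $p$-adic valuation of the integer $z$. The quantity $\mathcal{D}$ is always an integer. *)

theory Defs
  imports
    "HOL-Computational_Algebra.Computational_Algebra"
    "HOL-Number_Theory.Cong"
begin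

definition rad :: "int \<Rightarrow> int" where
  "rad k = \<Prod>(prime_factors k)"

definition wieferich_prime :: "int \<Rightarrow> nat \<Rightarrow> bool" where
  "wieferich_prime b p \<longleftrightarrow> prime p \<and> [b ^ (p - 1) = 1] (mod (int p)\<^sup>2)"

text \<open>The subfield \<open>\<rat>(\<theta>)\<close> of the complex numbers generated by \<open>\<theta>\<close>.\<close>

inductive_set rat_adjoin :: "complex \<Rightarrow> complex set" for \<theta> :: complex where
  of_rat: "of_rat q \<in> rat_adjoin \<theta>"
| gen: "\<theta> \<in> rat_adjoin \<theta>"
| add: "x \<in> rat_adjoin \<theta> \<Longrightarrow> y \<in> rat_adjoin \<theta> \<Longrightarrow> x + y \<in> rat_adjoin \<theta>"
| uminus: "x \<in> rat_adjoin \<theta> \<Longrightarrow> - x \<in> rat_adjoin \<theta>"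
| mult: "x \<in> rat_adjoin \<theta> \<Longrightarrow> y \<in> rat_adjoin \<theta> \<Longrightarrow> x * y \<in> rat_adjoin \<theta>"
| inverse: "x \<in> rat_adjoin \<theta> \<Longrightarrow> inverse x \<in> rat_adjoin \<theta>"

definition ring_of_integers :: "complex set \<Rightarrow> complex set" where
  "ring_of_integers K = {z \<in> K. algebraic_int z}"

definition int_scale :: "int \<Rightarrow> complex \<Rightarrow> complex" where
  "int_scale a z = of_int a * z"

interpretation int_module: module int_scale
  by unfold_locales (simp_all add: int_scale_def algebra_simps)

definition int_basis :: "complex set \<Rightarrow> complex set \<Rightarrow> bool" where
  "int_basis B M \<longleftrightarrow> int_module.independent B \<and> int_module.span B = M"

text \<open>
  The basis condition is required for every complex root \<open>\<theta>\<close> of \<open>f\<close>. Since \<open>f\<close> is irreducible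
  over the rationals, it has a root, all its roots are conjugate (so one root would do), and the
  listed powers of a root are pairwise distinct (so they may be collected in a set).
\<close>

definition monogenic :: "int poly \<Rightarrow> bool" where
  "monogenic f \<longleftrightarrow>
     lead_coeff f = 1 \<and>
     irreducible (map_poly of_int f :: rat poly) \<and>
     (\<forall>\<theta>::complex. poly (map_poly of_int f) \<theta> = 0 \<longrightarrow>
        int_basis ((\<lambda>i. \<theta> ^ i) ` {..<degree f}) (ring_of_integers (rat_adjoin \<theta>)))"

definition D_num :: "nat \<Rightarrow> int \<Rightarrow> int \<Rightarrow> int" where
  "D_num n b m =
     int n ^ n * (1 - b * m ^ (2 * n)) ^ (n + 1) + b * m ^ (2 * n) * (int n + 1) ^ (n + 1)"

definition D_den :: "nat \<Rightarrow> int \<Rightarrow> int \<Rightarrow> int" where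
  "D_den n b m = (1 + b * m ^ (2 * n) * int n)\<^sup>2"

text \<open>The division is exact; see \<open>D_den_dvd_D_num\<close> below for \<open>n = 2\<close>.\<close>

definition D_quot :: "nat \<Rightarrow> int \<Rightarrow> int \<Rightarrow> int" where
  "D_quot n b m = D_num n b m div D_den n b m"

lemma D_den_dvd_D_num: "D_den 2 b m dvd D_num 2 b m"
proof
  show "D_num 2 b m = D_den 2 b m * (4 - b * m ^ 4)"
    unfolding D_num_def D_den_def
    by (simp add: algebra_simps power2_eq_square power3_eq_cube power_numeral_reduce)
qed

lemma D_den_nonzero: "D_den 2 b m \<noteq> 0"
proof
  assume "D_den 2 b m = 0"
  hence "1 + b * m ^ 4 * 2 = 0" by (simp add: D_den_def)
  thus False by presburger
qed

text \<open>
  The product below divides \<open>D_quot n b m\<close> (the prime powers in it are pairwise coprime), so this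
  division is exact as well.
\<close>

definition d_part :: "nat \<Rightarrow> int \<Rightarrow> int \<Rightarrow> int" where
  "d_part n b m =
     \<bar>D_quot n b m\<bar> div (\<Prod>p\<in>prime_factors (b * m). p ^ multiplicity p (D_quot n b m))"

definition trinomial_F2 :: "int \<Rightarrow> int \<Rightarrow> nat \<Rightarrow> int poly" where
  "trinomial_F2 b m k = monom 1 (2 * k) + monom (b * m\<^sup>2) k + [:b:]"

end

theory Submission
  imports "Jordan_Normal_Form.Char_Poly" Defs "HOL-Computational_Algebra.Field_as_Ring"
begin

hide_const (open) Module.smult

text \<open>
  Let \<open>f\<close> be the trinomial, which is Eisenstein at every prime divisor of \<open>b\<close>, and \<open>\<theta>\<close> a root of it.
  If \<open>\<int>[\<theta>]\<close> is not maximal at a prime \<open>p\<close>, then \<open>f \<in> M\<^sup>2\<close> for a maximal ideal \<open>M = (p, g)\<close> of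
  \<open>\<int>[x]\<close> (Uchida's criterion), so that \<open>f' \<in> M\<close>. With \<open>y = x\<^sup>k\<close>, this gives
  \<open>x f' = k y (2 y + b m\<^sup>2) \<in> M\<close>. If \<open>y \<in> M\<close>, then \<open>p\<^sup>2\<close> divides \<open>b\<close>. If \<open>p\<close> divides \<open>m\<close>, in
  particular if it divides \<open>k\<close>, then \<open>y\<^sup>2 + b \<in> M\<^sup>2\<close>, which forces \<open>b \<equiv> -1 (mod 4)\<close> for \<open>p = 2\<close>
  and \<open>b\<^sup>p \<equiv> b (mod p\<^sup>2)\<close> for odd \<open>p\<close> dividing \<open>k\<close>. Otherwise
  \<open>4 f = (2 y + b m\<^sup>2)\<^sup>2 + b (4 - b m\<^sup>4)\<close> gives \<open>p\<^sup>2\<close> dividing \<open>\<D> = 4 - b m\<^sup>4\<close>. Conversely, if one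
  of the two conditions fails, \<open>(\<theta>\<^sup>k + 1) / 2\<close> or \<open>\<Sum>i<p. (-b) ^ (p - 1 - i) \<theta> ^ (2 i k / p) / p\<close> is an algebraic
  integer outside \<open>\<int>[\<theta>]\<close>.
\<close>

subsection \<open>Closure properties of algebraic integers\<close>

text \<open>The characteristic polynomial of an integer matrix is monic with integer coefficients
  and vanishes at every eigenvalue.\<close>

lemma algebraic_int_eigenvalue:
  fixes A :: "int mat" and v :: "complex vec"
  assumes A: "A \<in> carrier_mat n n" and v: "v \<in> carrier_vec n" "v \<noteq> 0\<^sub>v n"
    and ev: "map_mat of_int A *\<^sub>v v = x \<cdot>\<^sub>v v"
  shows "algebraic_int x"
proof -
  let ?A = "map_mat complex_of_int A"
  have A': "?A \<in> carrier_mat n n" using A by simp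
  have "eigenvalue ?A x"
    unfolding eigenvalue_def eigenvector_def using A v ev by auto
  hence "poly (char_poly ?A) x = 0"
    using eigenvalue_root_char_poly[OF A'] by blast
  hence "poly (map_poly of_int (char_poly A)) x = 0"
    by (simp add: of_int_hom.char_poly_hom[OF A])
  moreover have "lead_coeff (char_poly A) = 1"
    using degree_monic_char_poly[OF A] by simp
  ultimately show ?thesis by (auto simp: algebraic_int_altdef_ipoly)
qed

text \<open>Determinant trick: multiplication by \<open>x\<close> acts on the generators
  \<open>B\<close> through an integer matrix, and the vector listing \<open>B\<close> is an
  eigenvector for \<open>x\<close>. The element \<open>b0\<close> keeps that vector nonzero.\<close>

lemma algebraic_int_span:
  assumes fin: "finite B" and one: "b0 \<in> B" "b0 \<noteq> 0"
    and stable: "\<And>b. b \<in> B \<Longrightarrow> x * b \<in> int_module.span B"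
  shows "algebraic_int x"
proof -
  obtain h where h: "bij_betw h {0..<card B} B"
    using ex_bij_betw_nat_finite[OF fin] by blast
  define n where "n = card B"
  have "\<exists>u. x * b = (\<Sum>c\<in>B. of_int (u c) * c)" if "b \<in> B" for b
    using stable[OF that] unfolding int_module.span_finite[OF fin]
    by (auto simp: int_scale_def)
  then obtain u where u: "\<And>b. b \<in> B \<Longrightarrow> x * b = (\<Sum>c\<in>B. of_int (u b c) * c)" by metis
  define A where "A = mat n n (\<lambda>(i,j). u (h i) (h j))"
  define v where "v = vec n h"
  have hB: "h i \<in> B" if "i < n" for i
    using h that by (auto simp: bij_betw_def n_def)
  have sum_h: "(\<Sum>c\<in>B. g c) = (\<Sum>j = 0..<n. g (h j))" for g :: "complex \<Rightarrow> complex"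
    using sum.reindex_bij_betw[OF h, of g] by (simp add: n_def)
  have "\<exists>i<n. h i = b0"
    using h one by (force simp: bij_betw_def n_def image_iff)
  then obtain i0 where i0: "i0 < n" "h i0 = b0" by blast
  show ?thesis
  proof (rule algebraic_int_eigenvalue[of A n v])
    show "A \<in> carrier_mat n n" by (simp add: A_def)
    show "v \<in> carrier_vec n" by (simp add: v_def)
    show "v \<noteq> 0\<^sub>v n"
    proof
      assume "v = 0\<^sub>v n"
      hence "v $ i0 = 0" using i0 by simp
      thus False using i0 one by (simp add: v_def)
    qed
    show "map_mat of_int A *\<^sub>v v = x \<cdot>\<^sub>v v"
      by (rule eq_vecI) (auto simp: A_def v_def scalar_prod_def u[OF hB] sum_h)
  qed
qed

lemma span_mult_stable:
  assumes "\<And>b. b \<in> B \<Longrightarrow> x * b \<in> int_module.span B" and "z \<in> int_module.span B"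
  shows "x * z \<in> int_module.span B"
  using assms(2)
proof (induction rule: int_module.span_induct_alt)
  case base
  show ?case by (simp add: int_module.span_zero)
next
  case (step c b y)
  have "x * (int_scale c b + y) = int_scale c (x * b) + x * y"
    by (simp add: int_scale_def algebra_simps)
  thus ?case
    using assms(1)[OF step(1)] step by (simp add: int_module.span_add int_module.span_scale)
qed

lemma algebraic_int_power_eq:
  assumes "algebraic_int (x :: complex)"
  obtains N and c :: "nat \<Rightarrow> int" where "N > 0" "x ^ N = (\<Sum>i<N. of_int (c i) * x ^ i)"
proof -
  obtain P where P: "poly (map_poly of_int P) x = 0" "lead_coeff P = (1::int)"
    using assms by (auto simp: algebraic_int_altdef_ipoly)
  have d: "degree P > 0"
  proof (rule ccontr)
    assume "\<not> degree P > 0"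
    hence "P = [:1:]" using P(2) by (metis degree_0_id neq0_conv)
    thus False using P(1) by simp
  qed
  have "(\<Sum>i\<le>degree P. of_int (coeff P i) * x ^ i) = 0"
    using P(1) by (simp add: poly_altdef)
  hence "x ^ degree P = (\<Sum>i<degree P. of_int (- coeff P i) * x ^ i)"
    using P(2) by (simp add: lessThan_Suc_atMost[symmetric] sum_negf add_eq_0_iff)
  with d show ?thesis by (rule that)
qed

lemma poly_of_int_conv_sum:
  "poly (map_poly of_int P) (x :: complex) = (\<Sum>i\<le>degree P. of_int (coeff P i) * x ^ i)"
  by (simp add: poly_altdef)

text \<open>The span of the products \<open>y ^ i * z ^ j\<close> is a lattice stable under \<open>y\<close> and \<open>z\<close>, hence under
  every integral polynomial in \<open>y\<close> and \<open>z\<close>.\<close>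

lemma integral_extension_lattice:
  assumes y: "algebraic_int (y :: complex)" and e: "e > 0"
    and z: "z ^ e = (\<Sum>j<e. poly (map_poly of_int (U j)) y * z ^ j)"
  obtains B where "finite B" "1 \<in> B"
    "\<And>b. b \<in> B \<Longrightarrow> y * b \<in> int_module.span B" "\<And>b. b \<in> B \<Longrightarrow> z * b \<in> int_module.span B"
proof -
  obtain N c where N: "N > 0" "y ^ N = (\<Sum>i<N. of_int (c i) * y ^ i)"
    using algebraic_int_power_eq[OF y] .
  define B where "B = (\<lambda>(i,j). y ^ i * z ^ j) ` ({..<N} \<times> {..<e})"
  have mem: "y ^ i * z ^ j \<in> B" if "i < N" "j < e" for i j
    using that by (auto simp: B_def)
  have scaled: "of_int a * b \<in> int_module.span B" if "b \<in> int_module.span B" for a b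
    using int_module.span_scale[OF that, of a] by (simp add: int_scale_def)
  have Y: "y * b \<in> int_module.span B" if b: "b \<in> B" for b
  proof -
    obtain i j where ij: "b = y ^ i * z ^ j" "i < N" "j < e"
      using b by (auto simp: B_def)
    show ?thesis
    proof (cases "Suc i < N")
      case True
      thus ?thesis using mem[of "Suc i" j] ij by (simp add: int_module.span_base mult.assoc)
    next
      case False
      hence "Suc i = N" using ij by simp
      hence "y * b = y ^ N * z ^ j" by (simp add: ij mult.assoc flip: \<open>Suc i = N\<close>)
      also have "\<dots> = (\<Sum>i<N. of_int (c i) * (y ^ i * z ^ j))"
        by (simp add: N(2) sum_distrib_right mult.assoc)
      also have "\<dots> \<in> int_module.span B"
        using ij mem by (intro int_module.span_sum scaled int_module.span_base) auto
      finally show ?thesis .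
    qed
  qed
  have Ypow: "y ^ i * b \<in> int_module.span B" if "b \<in> int_module.span B" for i b
    by (induction i) (use that span_mult_stable[OF Y] in \<open>auto simp: mult.assoc\<close>)
  have Z: "z * b \<in> int_module.span B" if b: "b \<in> B" for b
  proof -
    obtain i j where ij: "b = y ^ i * z ^ j" "i < N" "j < e"
      using b by (auto simp: B_def)
    show ?thesis
    proof (cases "Suc j < e")
      case True
      have "z * b = y ^ i * z ^ Suc j" by (simp add: ij)
      also have "\<dots> \<in> int_module.span B"
        using mem[of i "Suc j"] ij True by (intro int_module.span_base)
      finally show ?thesis .
    next
      case False
      hence "Suc j = e" using ij by simp
      hence "z * b = y ^ i * z ^ e" by (simp add: ij flip: \<open>Suc j = e\<close>)
      \<comment> \<open>The factor \<open>y ^ 0\<close> exhibits a member of \<open>B\<close>; the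
        power \<open>y ^ (i + l)\<close> in front may exceed the range of exponents and is absorbed
        by \<open>Ypow\<close>.\<close>
      also have "\<dots> = (\<Sum>j<e. \<Sum>l\<le>degree (U j). of_int (coeff (U j) l) * (y ^ (i + l) * (y ^ 0 * z ^ j)))"
        by (simp add: z poly_of_int_conv_sum sum_distrib_left sum_distrib_right power_add mult_ac)
      also have "\<dots> \<in> int_module.span B"
        using N(1) mem by (intro int_module.span_sum scaled Ypow int_module.span_base mem) auto
      finally show ?thesis .
    qed
  qed
  show ?thesis
  proof (rule that)
    show "finite B" by (simp add: B_def)
    show "1 \<in> B" using mem[of 0 0] N(1) e by simp
  qed (use Y Z in blast)+
qed

text \<open>A lattice stable under both \<open>y\<close> and \<open>z\<close> is stable under their
  sum and product. It comes from \<open>integral_extension_lattice\<close> with constant polynomials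
  as coefficients.\<close>

lemma algebraic_int_add_mult:
  assumes "algebraic_int (y :: complex)" "algebraic_int z"
  shows algebraic_int_add: "algebraic_int (y + z)"
    and algebraic_int_mult: "algebraic_int (y * z)"
proof -
  obtain e c where e: "e > 0" "z ^ e = (\<Sum>i<e. of_int (c i) * z ^ i)"
    using algebraic_int_power_eq[OF assms(2)] .
  have "z ^ e = (\<Sum>i<e. poly (map_poly of_int [:c i:]) y * z ^ i)"
    unfolding e(2) by (simp add: of_int_hom.map_poly_pCons_hom)
  from integral_extension_lattice[OF assms(1) e(1) this]
  obtain B where B: "finite B" "1 \<in> B"
    "\<And>b. b \<in> B \<Longrightarrow> y * b \<in> int_module.span B" "\<And>b. b \<in> B \<Longrightarrow> z * b \<in> int_module.span B"
    by metis
  show "algebraic_int (y + z)"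
    by (rule algebraic_int_span[OF B(1,2)]) (auto simp: distrib_right intro!: int_module.span_add B)
  show "algebraic_int (y * z)"
    by (rule algebraic_int_span[OF B(1,2)])
       (simp_all add: mult.assoc span_mult_stable[OF B(3)] B(4))
qed

text \<open>Transitivity of integrality in degree two. The elements that witness non-maximality in
  \<open>half_integral\<close> and \<open>wieferich_integral\<close> are proved integral this
  way.\<close>

lemma algebraic_int_quadratic:
  assumes "algebraic_int (y :: complex)"
    and "z\<^sup>2 = poly (map_poly of_int U) y * z + poly (map_poly of_int V) y"
  shows "algebraic_int z"
proof -
  have "z ^ 2 = (\<Sum>j<2. poly (map_poly of_int (if j = 0 then V else U)) y * z ^ j)"
    using assms(2) by (simp add: numeral_2_eq_2)
  from integral_extension_lattice[OF assms(1) _ this]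
  obtain B where B: "finite B" "1 \<in> B" "\<And>b. b \<in> B \<Longrightarrow> z * b \<in> int_module.span B"
    by (metis pos2)
  show ?thesis
    by (rule algebraic_int_span[OF B(1,2)]) (auto intro: B)
qed

lemma algebraic_int_poly:
  assumes "algebraic_int (y :: complex)"
  shows "algebraic_int (poly (map_poly of_int P) y)"
  by (induction P) (auto intro: algebraic_int_add algebraic_int_mult assms)

subsection \<open>Ideals of \<open>\<int>[x]\<close> containing a prime number\<close>

text \<open>Makes the order Z[theta] available as \<open>range (ieval \<theta>)\<close>.\<close>

definition ieval :: "'a::comm_ring_1 \<Rightarrow> int poly \<Rightarrow> 'a" where
  "ieval \<theta> h = poly (map_poly of_int h) \<theta>"

lemma ieval_simps [simp]:
  "ieval \<theta> 0 = 0" "ieval \<theta> 1 = 1" "ieval \<theta> (of_int c) = of_int c"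
  "ieval \<theta> (g + h) = ieval \<theta> g + ieval \<theta> h" "ieval \<theta> (g - h) = ieval \<theta> g - ieval \<theta> h"
  "ieval \<theta> (- g) = - ieval \<theta> g" "ieval \<theta> (g * h) = ieval \<theta> g * ieval \<theta> h"
  "ieval \<theta> (g ^ n) = ieval \<theta> g ^ n" "ieval \<theta> (monom c n) = of_int c * \<theta> ^ n"
  "ieval \<theta> [:c:] = of_int c" "ieval \<theta> (numeral w) = numeral w"
  by (simp_all add: ieval_def hom_distribs poly_monom of_int_poly_hom.hom_power flip: of_int_poly)

lemma ieval_of_nat [simp]: "ieval \<theta> (of_nat n) = of_nat n"
  using ieval_simps(3)[of \<theta> "int n"] by simp

lemma ieval_sum [simp]: "ieval \<theta> (sum g A) = (\<Sum>i\<in>A. ieval \<theta> (g i))"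
  by (induction A rule: infinite_finite_induct) simp_all

section \<open>Division by monic integer polynomials\<close>

lemma of_int_dvd_poly_iff: "of_int p dvd (h :: int poly) \<longleftrightarrow> (\<forall>n. p dvd coeff h n)"
  by (simp add: of_int_poly const_poly_dvd_iff)

text \<open>Pseudo-division multiplies \<open>h\<close> by a power of the leading coefficient of
  \<open>g\<close>, which is 1 here.\<close>

lemma monic_division:
  fixes g h :: "int poly"
  assumes "lead_coeff g = 1"
  obtains q r where "h = g * q + r" "r = 0 \<or> degree r < degree g"
proof -
  have "g \<noteq> 0" using assms by auto
  obtain q r where qr: "pseudo_divmod h g = (q, r)" by (cases "pseudo_divmod h g")
  show ?thesis
    using pseudo_divmod[OF \<open>g \<noteq> 0\<close> qr] assms that by simp
qed

text \<open>A monic \<open>f\<close> is not divisible by \<open>p\<close>, so \<open>q\<close>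
  cannot vanish; then \<open>r\<close> has smaller degree than \<open>H * q\<close> and does not
  disturb its leading term.\<close>

lemma monic_quotient:
  fixes f :: "int poly"
  assumes f: "lead_coeff f = 1" and H: "lead_coeff H = 1"
    and eq: "f = H * q + r" "r = 0 \<or> degree r < degree H"
    and r: "of_int p dvd r" and p: "\<not> p dvd 1"
  shows "lead_coeff q = 1" "degree f = degree H + degree q"
proof -
  have "q \<noteq> 0"
  proof
    assume "q = 0"
    hence "of_int p dvd f" using eq r by simp
    thus False using f p by (metis of_int_dvd_poly_iff)
  qed
  have "H \<noteq> 0" using H by auto
  have d: "degree (H * q) = degree H + degree q"
    by (rule degree_mult_eq) fact+
  have l: "lead_coeff (H * q) = lead_coeff q"
    using H coeff_mult_degree_sum[of H q] by (simp add: d)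
  have "degree f = degree H + degree q \<and> lead_coeff q = 1"
  proof (cases "r = 0")
    case True
    thus ?thesis using eq d f l by simp
  next
    case False
    hence lt: "degree r < degree (H * q)" using eq d by simp
    have "degree f = degree (H * q)" using lt eq(1) by (simp add: degree_add_eq_left)
    moreover have "lead_coeff f = lead_coeff (H * q)"
      using lt eq(1) by (simp add: degree_add_eq_left coeff_eq_0)
    ultimately show ?thesis using d f l by simp
  qed
  thus "lead_coeff q = 1" "degree f = degree H + degree q" by auto
qed

section \<open>The ideals (p, g) of Z[x] and their squares\<close>

definition pmod_ideal :: "int \<Rightarrow> int poly \<Rightarrow> int poly set" where
  "pmod_ideal p g = {g * q + of_int p * r | q r. True}"

text \<open>The square of the ideal (p, g), through its generators g^2, p g and p^2.\<close>

definition pmod_ideal_sq :: "int \<Rightarrow> int poly \<Rightarrow> int poly set" where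
  "pmod_ideal_sq p g = {g\<^sup>2 * q + of_int p * g * s + (of_int p)\<^sup>2 * t | q s t. True}"

lemma pmod_idealI: "h = g * q + of_int p * r \<Longrightarrow> h \<in> pmod_ideal p g"
  by (auto simp: pmod_ideal_def)

lemma pmod_ideal_sqI:
  "h = g\<^sup>2 * q + of_int p * g * s + (of_int p)\<^sup>2 * t \<Longrightarrow> h \<in> pmod_ideal_sq p g"
  by (auto simp: pmod_ideal_sq_def)

lemma pmod_ideal_gens [simp, intro]: "g \<in> pmod_ideal p g" "of_int p \<in> pmod_ideal p g" "0 \<in> pmod_ideal p g"
  by (rule pmod_idealI[of _ _ 1 _ 0]; simp) (rule pmod_idealI[of _ _ 0 _ 1] pmod_idealI[of _ _ 0 _ 0]; simp)+

lemma pmod_ideal_add [intro]: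
  assumes "a \<in> pmod_ideal p g" "b \<in> pmod_ideal p g" shows "a + b \<in> pmod_ideal p g"
proof -
  obtain q r q' r' where "a = g * q + of_int p * r" "b = g * q' + of_int p * r'"
    using assms by (auto simp: pmod_ideal_def)
  thus ?thesis by (intro pmod_idealI[of _ _ "q + q'" _ "r + r'"]) (simp add: algebra_simps)
qed

lemma pmod_ideal_mult [intro]:
  assumes "a \<in> pmod_ideal p g"
  shows "b * a \<in> pmod_ideal p g" "a * b \<in> pmod_ideal p g"
proof -
  obtain q r where "a = g * q + of_int p * r"
    using assms by (auto simp: pmod_ideal_def)
  thus "b * a \<in> pmod_ideal p g" "a * b \<in> pmod_ideal p g"
    by (intro pmod_idealI[of _ _ "b * q" _ "b * r"]; simp add: algebra_simps)+
qed

lemma pmod_ideal_uminus_iff: "- a \<in> pmod_ideal p g \<longleftrightarrow> a \<in> pmod_ideal p g"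
  using pmod_ideal_mult(1)[of a p g "-1"] pmod_ideal_mult(1)[of "-a" p g "-1"] by auto

lemma pmod_ideal_diff [intro]:
  assumes "a \<in> pmod_ideal p g" "b \<in> pmod_ideal p g" shows "a - b \<in> pmod_ideal p g"
  using pmod_ideal_add[OF assms(1), of "- b"] assms(2) by (simp add: pmod_ideal_uminus_iff)

lemma pmod_ideal_sum:
  "(\<And>i. i \<in> A \<Longrightarrow> h i \<in> pmod_ideal p g) \<Longrightarrow> sum h A \<in> pmod_ideal p g"
  by (induction A rule: infinite_finite_induct) auto

lemma pmod_ideal_power:
  "a \<in> pmod_ideal p g \<Longrightarrow> n > 0 \<Longrightarrow> a ^ n \<in> pmod_ideal p g"
  by (cases n) auto

lemma pmod_ideal_dvd: "a \<in> pmod_ideal p g \<Longrightarrow> a dvd b \<Longrightarrow> b \<in> pmod_ideal p g"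
  by (auto elim!: dvdE)

lemma pmod_ideal_sq_add [intro]:
  assumes "a \<in> pmod_ideal_sq p g" "b \<in> pmod_ideal_sq p g" shows "a + b \<in> pmod_ideal_sq p g"
proof -
  obtain q s t q' s' t' where "a = g\<^sup>2 * q + of_int p * g * s + (of_int p)\<^sup>2 * t"
    "b = g\<^sup>2 * q' + of_int p * g * s' + (of_int p)\<^sup>2 * t'"
    using assms by (auto simp: pmod_ideal_sq_def)
  thus ?thesis
    by (intro pmod_ideal_sqI[of _ _ "q + q'" _ "s + s'" "t + t'"]) (simp add: algebra_simps)
qed

lemma pmod_ideal_sq_mult [intro]:
  assumes "a \<in> pmod_ideal_sq p g"
  shows "b * a \<in> pmod_ideal_sq p g" "a * b \<in> pmod_ideal_sq p g"
proof -
  obtain q s t where "a = g\<^sup>2 * q + of_int p * g * s + (of_int p)\<^sup>2 * t"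
    using assms by (auto simp: pmod_ideal_sq_def)
  thus "b * a \<in> pmod_ideal_sq p g" "a * b \<in> pmod_ideal_sq p g"
    by (intro pmod_ideal_sqI[of _ _ "b * q" _ "b * s" "b * t"]; simp add: algebra_simps)+
qed

lemma pmod_ideal_sq_diff [intro]:
  assumes "a \<in> pmod_ideal_sq p g" "b \<in> pmod_ideal_sq p g" shows "a - b \<in> pmod_ideal_sq p g"
  using pmod_ideal_sq_add[OF assms(1) pmod_ideal_sq_mult(1)[OF assms(2), of "-1"]] by simp

lemma pmod_ideal_sq_prod [intro]:
  assumes "a \<in> pmod_ideal p g" "b \<in> pmod_ideal p g" shows "a * b \<in> pmod_ideal_sq p g"
proof -
  obtain q r q' r' where "a = g * q + of_int p * r" "b = g * q' + of_int p * r'"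
    using assms by (auto simp: pmod_ideal_def)
  thus ?thesis
    by (intro pmod_ideal_sqI[of _ _ "q * q'" _ "q * r' + q' * r" "r * r'"])
       (simp add: algebra_simps power2_eq_square)
qed

lemma pmod_ideal_sq_dvd: "a \<in> pmod_ideal_sq p g \<Longrightarrow> a dvd b \<Longrightarrow> b \<in> pmod_ideal_sq p g"
  by (auto elim!: dvdE)

lemma pmod_ideal_sq_subset: "pmod_ideal_sq p g \<subseteq> pmod_ideal p g"
  by (auto simp: pmod_ideal_sq_def power2_eq_square mult.assoc)

text \<open>Modulo \<open>p\<close>, the polynomial \<open>u\<close> is a multiple of a monic
  polynomial of larger degree, hence zero. To compare degrees over the integers, the cofactor of
  \<open>p\<close> is first reduced modulo \<open>g\<close>.\<close>

lemma pmod_ideal_low_degree: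
  assumes u: "u \<in> pmod_ideal p g" and g: "lead_coeff g = 1" and d: "u = 0 \<or> degree u < degree g"
  shows "of_int p dvd u"
proof -
  obtain q r where qr: "u = g * q + of_int p * r" using u by (auto simp: pmod_ideal_def)
  obtain q' r' where r: "r = g * q' + r'" "r' = 0 \<or> degree r' < degree g"
    using monic_division[OF g] .
  have eq: "u - of_int p * r' = g * (q + of_int p * q')" by (simp add: qr r(1) algebra_simps)
  have "q + of_int p * q' = 0"
  proof (rule ccontr)
    assume nz: "q + of_int p * q' \<noteq> 0"
    have "g \<noteq> 0" using g by auto
    hence dg: "degree (u - of_int p * r') \<ge> degree g" "u - of_int p * r' \<noteq> 0"
      unfolding eq using nz by (simp_all add: degree_mult_eq)
    have dr: "r' = 0 \<or> degree (of_int p * r') < degree g"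
      using r(2) by (auto simp: of_int_poly dest: le_less_trans[OF degree_smult_le[of p r']])
    show False
    proof (cases "degree g = 0")
      \<comment> \<open>No degree lies below 0, so \<open>u\<close> and \<open>r'\<close> are both
        zero here.\<close>
      case True thus False using d r(2) dg by simp
    next
      case False
      hence "degree u < degree g" "degree (of_int p * r') < degree g" using d dr by auto
      hence "degree (u - of_int p * r') < degree g" by (rule degree_diff_less)
      thus False using dg by simp
    qed
  qed
  hence "u = of_int p * r'" using eq by simp
  thus ?thesis by simp
qed

text \<open>The euclidean argument for \<open>\<int>[x] / (p)\<close>: the leading coefficient of an element of least
  degree among those not divisible by \<open>p\<close> is invertible modulo \<open>p\<close>.\<close>

lemma ideal_containing_prime_principal:
  fixes p :: int and I :: "int poly set"
  assumes p: "prime p"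
    and add: "\<And>u v. u \<in> I \<Longrightarrow> v \<in> I \<Longrightarrow> u + v \<in> I"
    and mult: "\<And>u v. v \<in> I \<Longrightarrow> u * v \<in> I"
    and pI: "of_int p \<in> I" and h0: "h0 \<in> I" "\<not> of_int p dvd h0"
  obtains H where "lead_coeff H = 1" "H \<in> I" "I \<subseteq> pmod_ideal p H"
proof -
  define h where "h = arg_min degree (\<lambda>u. u \<in> I \<and> \<not> of_int p dvd u)"
  have h: "h \<in> I" "\<not> of_int p dvd h"
    and least: "\<And>u. u \<in> I \<Longrightarrow> \<not> of_int p dvd u \<Longrightarrow> degree h \<le> degree u"
    using arg_min_natI[of "\<lambda>u. u \<in> I \<and> \<not> of_int p dvd u" h0 degree]
      arg_min_nat_le[of "\<lambda>u. u \<in> I \<and> \<not> of_int p dvd u" _ degree] h0 by (auto simp: h_def)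
  have diff: "u - v \<in> I" if "u \<in> I" "v \<in> I" for u v
    using add[OF that(1) mult[OF that(2), of "-1"]] by simp
  have pmI: "of_int p * u \<in> I" for u
    using mult[OF pI, of u] by (simp add: mult.commute)
  \<comment> \<open>Otherwise removing the leading term, a multiple of \<open>p\<close>, would leave
    an element of \<open>I\<close> of smaller degree that is still not divisible by
    \<open>p\<close>.\<close>
  have lc: "\<not> p dvd lead_coeff h"
  proof
    assume "p dvd lead_coeff h"
    then obtain c where c: "lead_coeff h = p * c" by blast
    define u where "u = h - of_int p * monom c (degree h)"
    have uI: "u \<in> I" unfolding u_def by (intro diff h pmI)
    have up: "\<not> of_int p dvd u"
      using h(2) by (simp add: u_def dvd_diff_left_iff)
    have "u \<noteq> 0" using up by auto
    have "coeff u (degree h) = 0" by (simp add: u_def of_int_poly c)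
    moreover have "degree u \<le> degree h"
      unfolding u_def by (intro degree_diff_le order.refl)
        (auto simp: of_int_poly intro: order.trans[OF degree_smult_le] degree_monom_le)
    ultimately have "degree u < degree h"
      using \<open>u \<noteq> 0\<close> by (metis le_neq_implies_less leading_coeff_0_iff)
    thus False using least[OF uI up] by simp
  qed
  have "coprime (lead_coeff h) p"
    using lc p by (metis coprime_commute prime_imp_coprime)
  then obtain a c where ac: "a * lead_coeff h + c * p = 1"
    by (metis bezout_int coprime_imp_gcd_eq_1)
  \<comment> \<open>By the Bezout identity \<open>ac\<close>, the added multiple of \<open>p\<close>
    turns the leading coefficient of \<open>of_int a * h\<close> into 1.\<close>
  define H where "H = of_int a * h + of_int p * monom c (degree h)"
  have HI: "H \<in> I" unfolding H_def by (intro add mult h pmI)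
  have dH: "degree H \<le> degree h"
    unfolding H_def by (intro degree_add_le)
        (auto simp: of_int_poly intro: order.trans[OF degree_smult_le] degree_monom_le)
  have cH: "coeff H (degree h) = 1" using ac by (simp add: H_def of_int_poly mult.commute)
  have dH': "degree H = degree h" using dH cH by (simp add: le_antisym le_degree)
  have "I \<subseteq> pmod_ideal p H"
  proof
    fix u assume u: "u \<in> I"
    obtain q r where qr: "u = H * q + r" "r = 0 \<or> degree r < degree H"
      using monic_division[of H u] cH dH' by metis
    have "r = u - q * H" using qr by (simp add: mult.commute)
    hence "r \<in> I" using diff[OF u mult[OF HI]] by simp
    hence "of_int p dvd r" using least[of r] qr(2) dH' by fastforce
    then obtain r' where "r = of_int p * r'" by blast
    thus "u \<in> pmod_ideal p H" using qr(1) by (auto intro: pmod_idealI)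
  qed
  thus ?thesis using that[of H] HI cH dH' by simp
qed

section \<open>Prime ideals over p and Uchida's criterion\<close>

definition prime_pmod :: "int \<Rightarrow> int poly \<Rightarrow> bool" where
  "prime_pmod p g \<longleftrightarrow> lead_coeff g = 1 \<and> 1 \<notin> pmod_ideal p g \<and>
     (\<forall>u v. u * v \<in> pmod_ideal p g \<longrightarrow> u \<in> pmod_ideal p g \<or> v \<in> pmod_ideal p g)"

lemma prime_pmod_power:
  assumes "prime_pmod p g" "u ^ n \<in> pmod_ideal p g"
  shows "u \<in> pmod_ideal p g"
  using assms(2) by (induction n) (use assms(1) in \<open>auto simp: prime_pmod_def\<close>)

text \<open>For prime \<open>p\<close>, \<open>prime_pmod p g\<close> says that \<open>g\<close> is
  monic and irreducible modulo \<open>p\<close>; a nonconstant monic divisor of \<open>K\<close>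
  modulo \<open>p\<close> of least degree serves. If it divides \<open>u * v\<close>, the ideal
  \<open>J\<close> generated by \<open>p\<close>, \<open>g\<close> and \<open>u\<close> lies in some
  (p, H) with \<open>H\<close> monic in \<open>J\<close>. Either \<open>H = 1\<close>, which puts
  \<open>v\<close> into (p, g), or minimality makes \<open>H\<close> agree with \<open>g\<close>
  modulo \<open>p\<close>, which puts \<open>u\<close> there.\<close>

lemma exists_prime_pmod:
  assumes p: "prime p" and K: "lead_coeff K = 1" "degree K > 0"
  obtains g where "prime_pmod p g" "K \<in> pmod_ideal p g"
proof -
  let ?P = "\<lambda>g. lead_coeff g = 1 \<and> degree g > 0 \<and> K \<in> pmod_ideal p g"
  have np: "\<not> p dvd 1" using p by auto
  define g where "g = arg_min degree ?P"
  have g: "lead_coeff g = 1" "degree g > 0" "K \<in> pmod_ideal p g"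
    and least: "\<And>u. ?P u \<Longrightarrow> degree g \<le> degree u"
    using arg_min_natI[of ?P K degree] arg_min_nat_le[of ?P _ degree] K by (auto simp: g_def)
  have one: "1 \<notin> pmod_ideal p g"
  proof
    assume "1 \<in> pmod_ideal p g"
    hence "of_int p dvd (1 :: int poly)" using g by (intro pmod_ideal_low_degree) auto
    thus False using np by (metis of_int_dvd_poly_iff lead_coeff_1)
  qed
  have prime: "u \<in> pmod_ideal p g \<or> v \<in> pmod_ideal p g" if uv: "u * v \<in> pmod_ideal p g" for u v
  proof -
    define J where "J = {a * u + m | a m. m \<in> pmod_ideal p g}"
    have JI: "a * u + m \<in> J" if "m \<in> pmod_ideal p g" for a m using that by (auto simp: J_def)
    have gJ: "m \<in> J" if "m \<in> pmod_ideal p g" for m using JI[OF that, of 0] by simp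
    have uJ: "u \<in> J" using JI[of 0 1] by simp
    obtain H where H: "lead_coeff H = 1" "H \<in> J" "J \<subseteq> pmod_ideal p H"
    proof (rule ideal_containing_prime_principal[OF p, of J g])
      fix x y assume "x \<in> J" "y \<in> J"
      then obtain a m a' m' where "x = a * u + m" "y = a' * u + m'"
        "m \<in> pmod_ideal p g" "m' \<in> pmod_ideal p g" by (auto simp: J_def)
      thus "x + y \<in> J" using JI[of "m + m'" "a + a'"] by (auto simp: algebra_simps)
    next
      fix x y assume "y \<in> J"
      then obtain a m where "y = a * u + m" "m \<in> pmod_ideal p g" by (auto simp: J_def)
      thus "x * y \<in> J" using JI[of "x * m" "x * a"] by (auto simp: algebra_simps)
    next
      show "\<not> of_int p dvd g" using g np by (metis of_int_dvd_poly_iff)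
    qed (auto intro: gJ)
    show ?thesis
    proof (cases "degree H = 0")
      case True
      hence "H = 1" using H(1) by (metis degree_0_id one_poly_eq_simps(1))
      then obtain a m where "1 = a * u + m" "m \<in> pmod_ideal p g" using H(2) by (auto simp: J_def)
      hence "v = a * (u * v) + m * v" by (metis distrib_right mult.assoc mult_1)
      hence "v \<in> pmod_ideal p g" using uv \<open>m \<in> _\<close> by (metis pmod_ideal_add pmod_ideal_mult)
      thus ?thesis ..
    next
      case False
      have gH: "degree g \<le> degree H"
        using least[of H] H g(3) gJ False by auto
      obtain q r where qr: "g = H * q + r" "r = 0 \<or> degree r < degree H"
        using monic_division[OF H(1)] .
      have gm: "g \<in> pmod_ideal p H" using H(3) gJ by blast
      have "r = g - q * H" using qr(1) by (simp add: algebra_simps)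
      hence "r \<in> pmod_ideal p H" using gm by auto
      hence pr: "of_int p dvd r" using qr H(1) by (intro pmod_ideal_low_degree)
      from monic_quotient[OF g(1) H(1) qr pr np] gH have "degree q = 0" "lead_coeff q = 1" by auto
      hence "q = 1" by (metis degree_0_id one_poly_eq_simps(1))
      obtain r' where r': "r = of_int p * r'" using pr by blast
      obtain a c where "u = H * a + of_int p * c" using H(3) uJ by (auto simp: pmod_ideal_def)
      hence "u = g * a + of_int p * (c - r' * a)" using qr(1) \<open>q = 1\<close> r' by (simp add: algebra_simps)
      thus ?thesis using pmod_idealI by blast
    qed
  qed
  show ?thesis using that[of g] one prime g by (auto simp: prime_pmod_def)
qed

text \<open>Multiplying the integral equation of \<open>\<alpha>\<close> by the \<open>N\<close>-th
  power of the denominator \<open>c\<close> expresses \<open>d ^ N\<close>, up to a multiple of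
  \<open>f\<close>, by terms that all contain \<open>c\<close>. Primality then gives
  \<open>d\<close>.\<close>

lemma integral_quotient_mem_prime:
  assumes ker: "\<And>h. ieval \<theta> h = 0 \<Longrightarrow> f dvd h" and \<alpha>: "algebraic_int (\<alpha> :: complex)"
    and eq: "ieval \<theta> c * \<alpha> = ieval \<theta> d"
    and M: "prime_pmod p g" "f \<in> pmod_ideal p g" "c \<in> pmod_ideal p g"
  shows "d \<in> pmod_ideal p g"
proof -
  obtain N a where a: "N > 0" "\<alpha> ^ N = (\<Sum>i<N. of_int (a i) * \<alpha> ^ i)"
    using algebraic_int_power_eq[OF \<alpha>] .
  define s where "s = (\<Sum>i<N. of_int (a i) * (d ^ i * c ^ (N - i)))"
  have "ieval \<theta> (d ^ N) = ieval \<theta> c ^ N * \<alpha> ^ N"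
    by (simp flip: eq add: power_mult_distrib)
  also have "\<dots> = (\<Sum>i<N. of_int (a i) * ((ieval \<theta> c * \<alpha>) ^ i * ieval \<theta> c ^ (N - i)))"
    unfolding a(2) sum_distrib_left
    by (intro sum.cong refl) (auto simp: power_mult_distrib mult_ac simp flip: power_add)
  also have "\<dots> = ieval \<theta> s" by (simp add: s_def eq)
  finally have "f dvd d ^ N - s" by (intro ker) simp
  hence "d ^ N - s \<in> pmod_ideal p g" using M(2) by (rule pmod_ideal_dvd[rotated])
  moreover have "s \<in> pmod_ideal p g"
    unfolding s_def by (intro pmod_ideal_sum pmod_ideal_mult pmod_ideal_power M) auto
  ultimately have "d ^ N \<in> pmod_ideal p g" using pmod_ideal_add by fastforce
  thus ?thesis using prime_pmod_power M(1) by blast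
qed

text \<open>Uchida's criterion. The \<open>u\<close> with \<open>u(\<theta>) / p\<close> integral form an ideal \<open>(p, H)\<close>, and \<open>g\<close> is an
  irreducible factor modulo \<open>p\<close> of the cofactor \<open>K\<close> of \<open>H\<close> in \<open>f\<close>.\<close>

lemma not_maximal_imp_mem_square:
  fixes \<theta> :: complex and p :: int
  assumes f: "lead_coeff f = 1" "ieval \<theta> f = 0" and ker: "\<And>h. ieval \<theta> h = 0 \<Longrightarrow> f dvd h"
    and p: "prime p" and h: "algebraic_int (ieval \<theta> h / of_int p)"
    and nin: "\<And>w. ieval \<theta> h / of_int p \<noteq> ieval \<theta> w"
  obtains g where "prime_pmod p g" "f \<in> pmod_ideal_sq p g"
proof -
  have np: "\<not> p dvd 1" and p0: "p \<noteq> 0" using p by auto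
  have \<theta>: "algebraic_int \<theta>" using f by (auto simp: algebraic_int_altdef_ipoly ieval_def)
  define I where "I = {u. algebraic_int (ieval \<theta> u / of_int p)}"
  have add: "u + v \<in> I" if "u \<in> I" "v \<in> I" for u v
    using that by (auto simp: I_def add_divide_distrib intro: algebraic_int_add)
  have mult: "u * v \<in> I" if "v \<in> I" for u v
  proof -
    have "algebraic_int (ieval \<theta> u)" using algebraic_int_poly[OF \<theta>] by (simp add: ieval_def)
    thus ?thesis using that algebraic_int_mult[of "ieval \<theta> u" "ieval \<theta> v / of_int p"]
      by (auto simp: I_def)
  qed
  have pI: "of_int p \<in> I" using p0 by (simp add: I_def)
  have fI: "f \<in> I" by (simp add: I_def f)
  have hI: "h \<in> I" using h by (simp add: I_def)
  obtain H where H: "lead_coeff H = 1" "H \<in> I" "I \<subseteq> pmod_ideal p H"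
    using ideal_containing_prime_principal[OF p, of I f] add mult pI fI f(1) np
    by (metis of_int_dvd_poly_iff)
  obtain K R where KR: "f = H * K + R" "R = 0 \<or> degree R < degree H"
    using monic_division[OF H(1)] .
  have "R = f + (- K) * H" using KR(1) by (simp add: algebra_simps)
  hence "R \<in> I" using add fI mult H(2) by metis
  hence pR: "of_int p dvd R" using H KR(2) by (intro pmod_ideal_low_degree) auto
  then obtain R' where R': "R = of_int p * R'" by blast
  note K = monic_quotient[OF f(1) H(1) KR pR np]
  \<comment> \<open>If \<open>K\<close> were 1, then \<open>H\<close> would agree with
    \<open>f\<close> modulo \<open>p\<close>, and \<open>h\<close> in (p, f) would put its value
    divided by \<open>p\<close> into Z[theta].\<close>
  have dK: "degree K > 0"
  proof (rule ccontr)
    assume "\<not> degree K > 0"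
    hence "K = 1" using K(1) by (metis degree_0_id one_poly_eq_simps(1) neq0_conv)
    obtain q r where "h = H * q + of_int p * r" using hI H(3) by (auto simp: pmod_ideal_def)
    hence "h = f * q + of_int p * (r - R' * q)"
      using KR(1) \<open>K = 1\<close> R' by (simp add: algebra_simps)
    hence "ieval \<theta> h / of_int p = ieval \<theta> (r - R' * q)" using f(2) p0 by simp
    thus False using nin by blast
  qed
  obtain g where g: "prime_pmod p g" "K \<in> pmod_ideal p g"
    using exists_prime_pmod[OF p K(1) dK] .
  obtain K' S where K': "K = g * K' + of_int p * S" using g(2) by (auto simp: pmod_ideal_def)
  define F where "F = H * K'"
  define r where "r = H * S + R'"
  have fF: "f = g * F + of_int p * r"
    using KR(1) K' R' by (simp add: F_def r_def algebra_simps)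
  have FI: "algebraic_int (ieval \<theta> F / of_int p)"
    using mult[OF H(2), of K'] by (simp add: F_def I_def mult.commute)
  have fM: "f \<in> pmod_ideal p g" using fF by (rule pmod_idealI)
  have FM: "F \<in> pmod_ideal p g"
    by (rule integral_quotient_mem_prime[where \<theta> = \<theta> and c = "of_int p", OF ker FI _ g(1) fM])
      (use p0 in auto)
  \<comment> \<open>Dividing f(theta) = 0 by \<open>p\<close> makes -r(theta) the product of
    g(theta) and the integral number F(theta)/p. Thus \<open>r\<close> lies in the ideal like
    \<open>F\<close>, and both terms of \<open>fF\<close> become products of two of its
    elements.\<close>
  have "ieval \<theta> g * ieval \<theta> F + of_int p * ieval \<theta> r = 0"
    using f(2) by (simp add: fF)
  hence "ieval \<theta> g * (ieval \<theta> F / of_int p) = ieval \<theta> (- r)"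
    using p0 by (simp add: field_simps add_eq_0_iff)
  from integral_quotient_mem_prime[where \<theta> = \<theta>, OF ker FI this g(1) fM]
  have "- r \<in> pmod_ideal p g" by auto
  hence rM: "r \<in> pmod_ideal p g" by (simp add: pmod_ideal_uminus_iff)
  have "f \<in> pmod_ideal_sq p g"
    unfolding fF using FM rM by (intro pmod_ideal_sq_add pmod_ideal_sq_prod) auto
  thus ?thesis using that g(1) by blast
qed

section \<open>Integers and derivatives in (p, g) and its square\<close>

lemma of_int_mem_pmod_ideal:
  assumes g: "prime_pmod p g" and p: "prime p" and n: "of_int n \<in> pmod_ideal p g"
  shows "p dvd n"
proof (rule ccontr)
  assume "\<not> p dvd n"
  hence "coprime n p" using p by (metis coprime_commute prime_imp_coprime)
  then obtain a c where "a * n + c * p = 1" by (metis bezout_int coprime_imp_gcd_eq_1)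
  hence "1 = of_int a * of_int n + of_int c * (of_int p :: int poly)"
    by (metis of_int_1 of_int_add of_int_mult)
  moreover have "of_int a * of_int n + of_int c * of_int p \<in> pmod_ideal p g"
    using n by (intro pmod_ideal_add pmod_ideal_mult) auto
  ultimately show False using g by (metis prime_pmod_def)
qed

lemma prime_elem_of_int_poly:
  assumes "prime p" shows "prime_elem (of_int p :: int poly)"
  using prime_imp_prime_elem[OF assms] by (simp add: of_int_poly prime_elem_const_poly_iff)

text \<open>Write n = p n'. Then \<open>p\<close> divides g^2 q; being prime in Z[x] and not
  dividing the monic \<open>g\<close>, it divides \<open>q\<close>. Cancelling one factor
  \<open>p\<close> puts n' into (p, g).\<close>

lemma of_int_mem_pmod_ideal_sq:
  assumes g: "prime_pmod p g" and p: "prime p" and n: "of_int n \<in> pmod_ideal_sq p g"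
  shows "p\<^sup>2 dvd n"
proof -
  have p0: "p \<noteq> 0" using p by auto
  have mg: "lead_coeff g = 1" using g by (simp add: prime_pmod_def)
  have "p dvd n" using of_int_mem_pmod_ideal[OF g p] n pmod_ideal_sq_subset by blast
  then obtain n' where n': "n = p * n'" by blast
  obtain q s t where eq: "of_int n = g\<^sup>2 * q + of_int p * g * s + (of_int p)\<^sup>2 * t"
    using n by (auto simp: pmod_ideal_sq_def)
  have "g\<^sup>2 * q = of_int p * (of_int n' - g * s - of_int p * t)"
    using eq by (simp add: n' algebra_simps power2_eq_square)
  hence "of_int p dvd g\<^sup>2 * q" by simp
  moreover have "\<not> of_int p dvd g"
    using mg p by (metis of_int_dvd_poly_iff not_prime_unit)
  ultimately have "of_int p dvd q"
    using prime_elem_of_int_poly[OF p] by (metis power2_eq_square prime_elem_dvd_mult_iff)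
  then obtain q' where q': "q = of_int p * q'" by blast
  have "of_int p * of_int n' = of_int p * (g * (g * q' + s) + of_int p * t)"
    using eq by (simp add: n' q' algebra_simps power2_eq_square)
  hence "of_int n' = g * (g * q' + s) + of_int p * t"
    using p0 by (subst (asm) mult_cancel_left) auto
  hence "p dvd n'" using of_int_mem_pmod_ideal[OF g p] pmod_idealI by blast
  thus ?thesis by (auto simp: n' power2_eq_square)
qed

text \<open>By the product rule, each term of the derivative keeps a factor \<open>g\<close> or
  \<open>p\<close>.\<close>

lemma pderiv_mem_pmod_ideal:
  assumes "h \<in> pmod_ideal_sq p g" shows "pderiv h \<in> pmod_ideal p g"
proof -
  obtain q s t where eq: "h = g\<^sup>2 * q + of_int p * g * s + (of_int p)\<^sup>2 * t"
    using assms by (auto simp: pmod_ideal_sq_def)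
  have "pderiv h = g * (2 * pderiv g * q + g * pderiv q) + 
      of_int p * (pderiv (g * s) + of_int p * pderiv t)"
    unfolding eq by (simp add: pderiv_add pderiv_mult power2_eq_square of_int_poly pderiv_smult
        smult_add_right algebra_simps)
  thus ?thesis by (rule pmod_idealI)
qed

subsection \<open>The trinomial and squares of maximal ideals\<close>

text \<open>Additivity of Frobenius modulo \<open>p\<close>, in a general commutative ring because
  it is applied to integers and to polynomials.\<close>

lemma prime_dvd_power_add_diff:
  fixes u v :: "'a::comm_ring_1"
  assumes "prime (p::nat)"
  shows "of_nat p dvd (u + v) ^ p - (u ^ p + v ^ p)"
proof -
  have p0: "p > 0" using assms by (rule prime_gt_0_nat)
  let ?t = "\<lambda>k. of_nat (p choose k) * u ^ k * v ^ (p - k)"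
  have "{..p} = insert 0 (insert p {0<..<p})" using p0 by auto
  hence "(u + v) ^ p = u ^ p + v ^ p + (\<Sum>k\<in>{0<..<p}. ?t k)"
    using p0 by (subst binomial_ring) (simp add: algebra_simps)
  moreover have "of_nat p dvd (\<Sum>k\<in>{0<..<p}. ?t k)"
  proof (intro dvd_sum)
    fix k assume "k \<in> {0<..<p}"
    hence "p dvd (p choose k)" using assms by (intro dvd_choose_prime) auto
    hence "of_nat p dvd (of_nat (p choose k) :: 'a)" by (auto simp: dvd_def)
    thus "of_nat p dvd ?t k" by simp
  qed
  ultimately show ?thesis by simp
qed

lemma prime_dvd_power_diff_self:
  assumes "prime (p::nat)" "b \<ge> 0"
  shows "int p dvd b ^ p - b"
proof -
  have "int p dvd int n ^ p - int n" for n
  proof (induction n)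
    case 0
    show ?case using prime_gt_0_nat[OF assms(1)] by (simp add: zero_power)
  next
    case (Suc n)
    have "int p dvd (int n + 1) ^ p - (int n ^ p + 1 ^ p)"
      using prime_dvd_power_add_diff[OF assms(1), of "int n" 1] by simp
    from dvd_add[OF this Suc] show ?case by (simp add: algebra_simps)
  qed
  from this[of "nat b"] show ?thesis using assms(2) by simp
qed

lemma power_diff_dvd: "(u - v :: 'a::comm_ring_1) dvd u ^ n - v ^ n"
  by (metis dvd_triv_left power_diff_sumr2)

lemma trinomial_F2_eq:
  "trinomial_F2 b m k = (monom 1 k)\<^sup>2 + of_int (b * m\<^sup>2) * monom 1 k + of_int b"
  by (simp add: trinomial_F2_def monom_power of_int_poly smult_monom mult.commute)

text \<open>The extra factor x replaces x^(k-1) by x^k, so that the derivative factors in terms of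
  x^k alone.\<close>

lemma x_mult_pderiv_trinomial_F2:
  assumes "k \<ge> 1"
  shows "monom 1 1 * pderiv (trinomial_F2 b m k) =
    of_int (int k) * (monom 1 k * (of_int 2 * monom 1 k + of_int (b * m\<^sup>2)))"
proof -
  have "monom 1 1 * pderiv (trinomial_F2 b m k) = monom (2 * int k) (2 * k) + monom (int k * (b * m\<^sup>2)) k"
    using assms by (simp add: trinomial_F2_def pderiv_add pderiv_monom pderiv_pCons mult_monom distrib_left)
  also have "\<dots> = of_int (int k) * (of_int 2 * monom 1 (2 * k) + of_int (b * m\<^sup>2) * monom 1 k)"
    by (simp add: of_int_poly smult_monom smult_add_right mult.commute)
  also have "monom 1 (2 * k) = monom 1 k * (monom 1 k :: int poly)"
    by (simp add: mult_monom mult_2)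
  finally show ?thesis by (simp only: algebra_simps)
qed

text \<open>Each local hypothesis excludes one case: \<open>sqfree\<close> that x^k lies in (p, g),
  \<open>two\<close> that \<open>p\<close> is 2, \<open>wief\<close> that an odd \<open>p\<close>
  divides \<open>k\<close>, and \<open>disc\<close> the remaining odd \<open>p\<close>.\<close>

lemma trinomial_F2_not_mem_square:
  fixes b m :: int and p k :: nat
  assumes k: "k \<ge> 1" and b: "b \<ge> 0" and p: "prime p" and g: "prime_pmod (int p) g"
    and sqfree: "\<not> (int p)\<^sup>2 dvd b" and km: "p dvd k \<Longrightarrow> int p dvd m"
    and two: "p = 2 \<Longrightarrow> even m \<Longrightarrow> \<not> 4 dvd b + 1"
    and wief: "odd p \<Longrightarrow> p dvd k \<Longrightarrow> \<not> (int p)\<^sup>2 dvd b ^ p - b"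
    and disc: "odd p \<Longrightarrow> \<not> int p dvd b \<Longrightarrow> \<not> int p dvd m \<Longrightarrow> \<not> (int p)\<^sup>2 dvd 4 - b * m ^ 4"
  shows "trinomial_F2 b m k \<notin> pmod_ideal_sq (int p) g"
proof
  let ?P = "int p" and ?M = "pmod_ideal (int p) g" and ?M2 = "pmod_ideal_sq (int p) g"
  define y :: "int poly" where "y = monom 1 k"
  define f where "f = trinomial_F2 b m k"
  assume "trinomial_F2 b m k \<in> ?M2"
  hence fM2: "f \<in> ?M2" by (simp add: f_def)
  hence fM: "f \<in> ?M" using pmod_ideal_sq_subset by blast
  have f: "f = y\<^sup>2 + of_int (b * m\<^sup>2) * y + of_int b"
    by (simp only: f_def y_def trinomial_F2_eq)
  have P: "prime ?P" using p by simp
  have intM: "?P dvd n" if "of_int n \<in> ?M" for n using of_int_mem_pmod_ideal[OF g P that] .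
  have intM': "of_int n \<in> ?M" if n: "?P dvd n" for n
  proof -
    obtain c where "n = ?P * c" using n by blast
    hence "of_int n = of_int ?P * (of_int c :: int poly)" by (simp only: of_int_mult)
    thus ?thesis by (simp only: pmod_ideal_mult(2)[OF pmod_ideal_gens(2)])
  qed
  have intM2: "?P\<^sup>2 dvd n" if "of_int n \<in> ?M2" for n using of_int_mem_pmod_ideal_sq[OF g P that] .
  have intM2': "of_int n \<in> ?M2" if "?P\<^sup>2 dvd n" for n
  proof -
    have "of_int ?P * of_int ?P \<in> ?M2" by (intro pmod_ideal_sq_prod pmod_ideal_gens)
    thus ?thesis using that pmod_ideal_sq_dvd by (auto simp: dvd_def power2_eq_square)
  qed
  have prime: "u \<in> ?M \<or> v \<in> ?M" if "u * v \<in> ?M" for u v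
    using g that by (auto simp: prime_pmod_def)
  have y: "y \<notin> ?M"
  proof
    assume y: "y \<in> ?M"
    have b_eq: "of_int b = f - y * y - of_int (b * m\<^sup>2) * y"
      by (simp add: f power2_eq_square)
    \<comment> \<open>Since \<open>b\<close> lies in the ideal, b y is a product of two elements of
      it, and so \<open>b_eq\<close> places \<open>b\<close> in the square.\<close>
    have "of_int b \<in> ?M" unfolding b_eq using y fM by (intro pmod_ideal_diff pmod_ideal_mult)
    hence "of_int b * y \<in> ?M2" using y by blast
    hence "of_int (b * m\<^sup>2) * y \<in> ?M2"
      using pmod_ideal_sq_mult(1)[of "of_int b * y" ?P g "of_int (m\<^sup>2)"] by (simp add: mult_ac)
    hence "of_int b \<in> ?M2" unfolding b_eq using fM2 pmod_ideal_sq_prod[OF y y]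
      by (intro pmod_ideal_sq_diff)
    thus False using intM2 sqfree by blast
  qed
  have nb: "\<not> ?P dvd b"
  proof
    assume "?P dvd b"
    hence "of_int b \<in> ?M" by (rule intM')
    hence "f - y * of_int (m\<^sup>2) * of_int b - of_int b \<in> ?M" using fM by blast
    moreover have "f - y * of_int (m\<^sup>2) * of_int b - of_int b = y * y"
      by (simp add: f power2_eq_square algebra_simps)
    ultimately show False using prime y by auto
  qed
  have sq: "y\<^sup>2 + of_int b \<in> ?M2" if "?P dvd m"
  proof -
    have "of_int (b * m\<^sup>2) \<in> ?M2" using that by (intro intM2') (simp add: dvd_power_same)
    hence "f - of_int (b * m\<^sup>2) * y \<in> ?M2" using fM2 by blast
    thus ?thesis by (simp add: f)
  qed
  have "monom 1 1 * pderiv f \<in> ?M" using pderiv_mem_pmod_ideal[OF fM2] by blast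
  hence "of_int (int k) * (y * (of_int 2 * y + of_int (b * m\<^sup>2))) \<in> ?M"
    by (simp only: x_mult_pderiv_trinomial_F2[OF k] f_def y_def)
  hence cases: "of_int (int k) \<in> ?M \<or> of_int 2 * y + of_int (b * m\<^sup>2) \<in> ?M"
    using prime y by blast
  show False
  proof (cases "p = 2")
    case True
    \<comment> \<open>Either 2 divides \<open>k\<close>, and \<open>km\<close> applies, or 2 y drops
      out of the linear factor and leaves b m^2 even with \<open>b\<close> odd.\<close>
    have "?P dvd m"
    proof (cases "of_int (int k) \<in> ?M")
      case True
      thus ?thesis using km intM[OF True] by simp
    next
      case False
      hence "of_int 2 * y + of_int (b * m\<^sup>2) \<in> ?M" using cases by blast
      moreover have "of_int 2 * y \<in> ?M" using \<open>p = 2\<close> intM'[of 2] by (intro pmod_ideal_mult) simp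
      ultimately have "of_int 2 * y + of_int (b * m\<^sup>2) - of_int 2 * y \<in> ?M" by blast
      hence "?P dvd b * m\<^sup>2" using intM by simp
      thus ?thesis using nb P by (metis prime_dvd_multD prime_dvd_power)
    qed
    hence m: "even m" "?P dvd m" using True by auto
    have "odd b" using nb True by simp
    have "y\<^sup>2 + of_int b \<in> ?M" using sq[OF m(2)] pmod_ideal_sq_subset by blast
    moreover have "of_int (b - 1) \<in> ?M" using \<open>odd b\<close> True by (intro intM') simp
    moreover have "of_int 2 * y \<in> ?M" using True intM'[of 2] by (intro pmod_ideal_mult) simp
    ultimately have "y\<^sup>2 + of_int b - of_int (b - 1) + of_int 2 * y \<in> ?M" by blast
    also have "y\<^sup>2 + of_int b - of_int (b - 1) + of_int 2 * y = (y + 1) * (y + 1)"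
      by (simp add: power2_eq_square algebra_simps)
    finally have y1: "y + 1 \<in> ?M" using prime by blast
    have "of_int 2 \<in> ?M" using True intM'[of 2] by simp
    \<comment> \<open>Modulo 2 the square of \<open>y + 1\<close> is y^2 + b; the combination chosen
      here cancels \<open>y\<close> and has every part in the square of the ideal.\<close>
    hence "(y\<^sup>2 + of_int b) - (y + 1) * (y + 1) + of_int 2 * (y + 1) \<in> ?M2"
      using y1 sq[OF m(2)] by blast
    also have "(y\<^sup>2 + of_int b) - (y + 1) * (y + 1) + of_int 2 * (y + 1) = of_int (b + 1)"
      by (simp add: power2_eq_square algebra_simps)
    finally have "?P\<^sup>2 dvd b + 1" by (rule intM2)
    thus False using two[OF True m(1)] True by simp
  next
    case False
    hence odd: "odd p" using p primes_dvd_imp_eq two_is_prime_nat by blast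
    show False
    proof (cases "p dvd k")
      case True
      then obtain k1 where k1: "k = p * k1" by blast
      define Y :: "int poly" where "Y = monom 1 (2 * k1)"
      have YP: "Y ^ p = y\<^sup>2" by (simp add: Y_def y_def monom_power k1 mult_ac)
      have Yb2: "Y ^ p + of_int b \<in> ?M2" using sq km True by (simp add: YP)
      hence YbM: "Y ^ p + of_int b \<in> ?M" using pmod_ideal_sq_subset by blast
      have "of_int (b ^ p - b) \<in> ?M"
        by (intro intM' prime_dvd_power_diff_self p b)
      moreover have "(Y + of_int b) ^ p - (Y ^ p + of_int b ^ p) \<in> ?M"
        by (rule pmod_ideal_dvd[OF pmod_ideal_gens(2)])
           (use prime_dvd_power_add_diff[OF p, of Y "of_int b"] in simp)
      \<comment> \<open>Frobenius and Fermat: modulo \<open>p\<close>, Y^p + b is the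
        \<open>p\<close>-th power of Y + b.\<close>
      ultimately have "(Y ^ p + of_int b) + of_int (b ^ p - b) +
          ((Y + of_int b) ^ p - (Y ^ p + of_int b ^ p)) \<in> ?M"
        using YbM by blast
      hence "(Y + of_int b) ^ p \<in> ?M" by simp
      hence Y1: "Y + of_int b \<in> ?M" using prime_pmod_power[OF g] by blast
      define c :: "int poly" where "c = - of_int b"
      have Yc: "Y - c \<in> ?M" using Y1 by (simp add: c_def)
      \<comment> \<open>The quotient of Y^p - c^p by Y - c. Modulo Y - c every summand is c^(p-1),
        so \<open>S\<close> is congruent to p c^(p-1) and lies in the ideal.\<close>
      define S where "S = (\<Sum>i<p. c ^ (p - Suc i) * Y ^ i)"
      have "S = (\<Sum>i<p. c ^ (p - Suc i) * (Y ^ i - c ^ i)) + (\<Sum>i<p. c ^ (p - Suc i) * c ^ i)"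
        by (simp add: S_def algebra_simps flip: sum.distrib)
      also have "(\<Sum>i<p. c ^ (p - Suc i) * c ^ i) = of_int ?P * c ^ (p - 1)"
        by (simp flip: power_add)
      finally have S_eq: "S = (\<Sum>i<p. c ^ (p - Suc i) * (Y ^ i - c ^ i)) + of_int ?P * c ^ (p - 1)" .
      have "S \<in> ?M"
        unfolding S_eq
        by (intro pmod_ideal_add pmod_ideal_sum pmod_ideal_mult pmod_ideal_gens pmod_ideal_dvd[OF Yc] power_diff_dvd)
      hence "(Y - c) * S \<in> ?M2" using Yc by blast
      also have "(Y - c) * S = Y ^ p - c ^ p" unfolding S_def by (rule power_diff_sumr2[symmetric])
      also have "\<dots> = Y ^ p + of_int b ^ p" using odd by (simp add: c_def)
      finally have "(Y ^ p + of_int b ^ p) - (Y ^ p + of_int b) \<in> ?M2" using Yb2 by blast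
      hence "of_int (b ^ p - b) \<in> ?M2" by simp
      thus False using intM2 wief[OF odd True] by blast
    next
      case False
      hence kM: "of_int (int k) \<notin> ?M" using intM[of "int k"] by auto
      hence lin: "of_int 2 * y + of_int (b * m\<^sup>2) \<in> ?M" using cases by blast
      have "\<not> ?P dvd 2" using odd p
        by (metis int_dvd_int_iff of_nat_numeral primes_dvd_imp_eq two_is_prime_nat even_numeral)
      hence two: "of_int 2 \<notin> ?M" using intM by blast
      have nm: "\<not> ?P dvd m"
      proof
        assume "?P dvd m"
        hence "of_int (b * m\<^sup>2) \<in> ?M" by (intro intM') (simp add: power2_eq_square)
        hence "of_int 2 * y + of_int (b * m\<^sup>2) - of_int (b * m\<^sup>2) \<in> ?M" using lin by blast
        hence "of_int 2 * y \<in> ?M" by simp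
        thus False using prime two y by blast
      qed
      have "of_int 4 * f - (of_int 2 * y + of_int (b * m\<^sup>2)) * (of_int 2 * y + of_int (b * m\<^sup>2)) \<in> ?M2"
        using fM2 lin by blast
      also have "of_int 4 * f - (of_int 2 * y + of_int (b * m\<^sup>2)) * (of_int 2 * y + of_int (b * m\<^sup>2))
          = of_int (b * (4 - b * m ^ 4))"
        by (simp add: f power2_eq_square algebra_simps power4_eq_xxxx)
      finally have "?P\<^sup>2 dvd b * (4 - b * m ^ 4)" by (rule intM2)
      moreover have "coprime (?P\<^sup>2) b" using nb P by (simp add: prime_imp_coprime)
      ultimately have "?P\<^sup>2 dvd 4 - b * m ^ 4" by (simp add: coprime_dvd_mult_right_iff)
      thus False using disc odd nb nm by blast
    qed
  qed
qed

subsection \<open>Integral bases of powers of a root\<close>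

lemma clear_denominators:
  fixes u :: "rat poly"
  obtains a U where "a > 0" "smult (of_int a) u = map_poly of_int U"
proof -
  have "\<exists>a>0. \<exists>U. smult (of_int a) u = map_poly of_int U"
  proof (induction u)
    case 0
    show ?case by (intro exI[of _ 1] conjI exI[of _ 0]) auto
  next
    case (pCons c u)
    then obtain a U where aU: "a > 0" "smult (of_int a) u = map_poly of_int U" by blast
    obtain n d where c: "c = of_int n / of_int d" "d > 0"
      using quotient_of_div[of c] quotient_of_denom_pos[of c] by (metis prod.exhaust)
    have "smult (of_int (d * a)) (pCons c u) = pCons (of_int (a * n)) (smult (of_int d) (smult (of_int a) u))"
      using c by simp
    also have "\<dots> = map_poly of_int (pCons (a * n) (smult d U))"
      by (simp add: aU(2) hom_distribs)
    finally show ?case using aU(1) c(2) by (meson mult_pos_pos)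
  qed
  thus ?thesis using that by blast
qed

text \<open>At the least index \<open>i\<close> where \<open>p\<close> does not divide the
  coefficient of \<open>A\<close>, the product has coefficient a_i b_0 modulo \<open>p\<close>,
  although \<open>i\<close> is below its degree.\<close>

lemma eisenstein_coprime_factor:
  fixes A B :: "int poly"
  assumes p: "prime p" and dvd: "\<And>i. i < degree (A * B) \<Longrightarrow> p dvd coeff (A * B) i"
    and B: "\<not> p dvd coeff B 0" and A: "\<not> p dvd lead_coeff A" and d: "degree A < degree (A * B)"
  shows False
proof -
  define i where "i = (LEAST i. \<not> p dvd coeff A i)"
  have i: "\<not> p dvd coeff A i" unfolding i_def by (rule LeastI[of _ "degree A"]) (rule A)
  have less: "p dvd coeff A j" if "j < i" for j using not_less_Least[of j] that by (auto simp: i_def)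
  have "i \<le> degree A" unfolding i_def by (rule Least_le) (rule A)
  hence "p dvd coeff (A * B) i" using d by (intro dvd) simp
  also have "coeff (A * B) i = (\<Sum>j<i. coeff A j * coeff B (i - j)) + coeff A i * coeff B 0"
    by (simp add: coeff_mult lessThan_Suc_atMost[symmetric])
  finally have "p dvd coeff A i * coeff B 0"
    using less by (subst (asm) dvd_add_right_iff) (auto intro!: dvd_sum)
  thus False using i B p by (simp add: prime_dvd_mult_iff)
qed

text \<open>By Gauss's lemma, a rational factorization becomes one into primitive integer
  polynomials of the same degrees. As p^2 does not divide the constant term, one factor has constant
  term prime to \<open>p\<close>, against \<open>eisenstein_coprime_factor\<close>.\<close>

lemma eisenstein_irreducible:
  fixes f :: "int poly"
  assumes p: "prime p" and f: "lead_coeff f = 1" "degree f > 0"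
    and dvd: "\<And>i. i < degree f \<Longrightarrow> p dvd coeff f i" and sq: "\<not> p\<^sup>2 dvd coeff f 0"
  shows "irreducible (map_poly of_int f :: rat poly)"
proof (rule irreducibleI)
  let ?f = "map_poly of_int f :: rat poly"
  have df: "degree ?f = degree f" by simp
  show "?f \<noteq> 0" using f by auto
  show "\<not> ?f dvd 1" using f df by (simp add: poly_dvd_1)
  fix u v assume uv: "?f = u * v"
  show "u dvd 1 \<or> v dvd 1"
  proof (rule ccontr)
    assume "\<not> (u dvd 1 \<or> v dvd 1)"
    moreover have nz: "u \<noteq> 0" "v \<noteq> 0" using uv \<open>?f \<noteq> 0\<close> by auto
    ultimately have d: "degree u > 0" "degree v > 0"
      by (auto simp: is_unit_iff_degree)
    obtain a U where U: "a > 0" "smult (of_int a) u = map_poly of_int U" by (rule clear_denominators)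
    obtain c V where V: "c > 0" "smult (of_int c) v = map_poly of_int V" by (rule clear_denominators)
    have "map_poly of_int (smult (a * c) f) = smult (of_int a) u * smult (of_int c) v"
      by (simp add: hom_distribs uv mult.commute)
    also have "\<dots> = map_poly of_int (U * V)" by (simp only: U V hom_distribs)
    finally have eq: "smult (a * c) f = U * V" by (simp only: of_int_poly_hom.eq_iff)
    have "content f dvd 1" using content_dvd_coeff[of f "degree f"] f(1) by simp
    hence cf: "content f = 1" by (metis is_unit_content_iff normalize_content)
    have "content (U * V) = a * c" using U(1) V(1) cf
      by (simp flip: eq add: abs_mult)
    hence cc: "content U * content V = a * c" by (simp add: content_mult)
    define A where "A = primitive_part U"
    define B where "B = primitive_part V"
    have "smult (a * c) f = smult (content U) A * smult (content V) B"
      by (simp only: A_def B_def eq content_times_primitive_part)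
    also have "\<dots> = smult (a * c) (A * B)" by (simp add: mult.commute flip: cc)
    finally have "smult (a * c) f = smult (a * c) (A * B)" .
    hence fAB: "f = A * B" using U(1) V(1) mult_left_cancel[of "[:a * c:]" f "A * B"] by simp
    have "degree A = degree u" "degree B = degree v"
    proof -
      have "degree U = degree u" "degree V = degree v"
        using arg_cong[OF U(2), of degree] arg_cong[OF V(2), of degree] U(1) V(1) by simp_all
      thus "degree A = degree u" "degree B = degree v" by (simp_all add: A_def B_def)
    qed
    hence dA: "degree A > 0" "degree B > 0" using d by simp_all
    hence "A \<noteq> 0" "B \<noteq> 0" by auto
    hence dAB: "degree f = degree A + degree B" unfolding fAB by (rule degree_mult_eq)
    have "lead_coeff A * lead_coeff B = 1"
      using f(1) by (simp add: fAB lead_coeff_mult[symmetric])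
    hence lc: "\<not> p dvd lead_coeff A" "\<not> p dvd lead_coeff B"
      using p by (metis dvd_mult2 dvd_mult dvd_trans not_prime_unit)+
    have f0: "coeff f 0 = coeff A 0 * coeff B 0" by (simp add: fAB coeff_mult_0)
    have "\<not> p dvd coeff A 0 \<or> \<not> p dvd coeff B 0"
      using sq by (auto simp: f0 power2_eq_square mult_dvd_mono)
    thus False
    proof
      assume "\<not> p dvd coeff B 0"
      thus False using eisenstein_coprime_factor[OF p, of A B] dvd lc dAB dA fAB by simp
    next
      assume "\<not> p dvd coeff A 0"
      thus False using eisenstein_coprime_factor[OF p, of B A] dvd lc dAB dA fAB by (simp add: mult.commute)
    qed
  qed
qed

text \<open>A nonzero remainder modulo \<open>f\<close> is coprime to \<open>f\<close> over the
  rationals; the identity arises by clearing denominators. It yields both the kernel of evaluation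
  and inverses in Q(theta).\<close>

lemma irreducible_monic_dvd_or_bezout:
  fixes f h :: "int poly"
  assumes f: "lead_coeff f = 1" and irr: "irreducible (map_poly of_int f :: rat poly)"
  shows "f dvd h \<or> (\<exists>U V a. a \<noteq> 0 \<and> U * h + V * f = of_int a)"
proof -
  obtain q r where qr: "h = f * q + r" "r = 0 \<or> degree r < degree f"
    using monic_division[OF f] .
  show ?thesis
  proof (cases "r = 0")
    case True
    thus ?thesis using qr by simp
  next
    case False
    let ?f = "map_poly of_int f :: rat poly" and ?r = "map_poly of_int r :: rat poly"
    have "?r \<noteq> 0" "degree ?r < degree ?f" using False qr by simp_all
    hence "\<not> ?f dvd ?r" by (metis dvd_imp_degree_le leD)
    hence "coprime ?f ?r"
      by (rule prime_elem_imp_coprime[OF irreducible_imp_prime_elem_gcd[OF irr]])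
    then obtain v u where vu: "v * ?f + u * ?r = 1"
      by (metis bezout_coefficients_fst_snd coprime_imp_gcd_eq_1)
    obtain a U where U: "a > 0" "smult (of_int a) u = map_poly of_int U" by (rule clear_denominators)
    obtain c V where V: "c > 0" "smult (of_int c) v = map_poly of_int V" by (rule clear_denominators)
    have "smult (of_int (a * c)) 1 =
        smult (of_int a) (smult (of_int c) v * ?f) + smult (of_int c) (smult (of_int a) u * ?r)"
      by (simp flip: vu add: smult_add_right mult.commute)
    also have "\<dots> = map_poly of_int (smult a (V * f) + smult c (U * r))"
      by (simp only: U V hom_distribs)
    finally have "map_poly of_int (smult (a * c) 1) =
        (map_poly of_int (smult a (V * f) + smult c (U * r)) :: rat poly)"
      by (simp only: hom_distribs of_int_poly_hom.hom_one)
    hence "smult (a * c) 1 = smult a (V * f) + smult c (U * r)" by (simp only: of_int_poly_hom.eq_iff)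
    hence "smult c U * h + (smult a V - smult c U * q) * f = of_int (a * c)"
      using qr(1) by (simp add: of_int_poly algebra_simps smult_add_right)
    thus ?thesis using U(1) V(1) by (metis mult_pos_pos less_irrefl)
  qed
qed

lemma ieval_eq_0_imp_dvd:
  fixes \<theta> :: complex
  assumes f: "lead_coeff f = 1" "irreducible (map_poly of_int f :: rat poly)" "ieval \<theta> f = 0"
    and h: "ieval \<theta> h = 0"
  shows "f dvd h"
proof (rule ccontr)
  assume "\<not> f dvd h"
  then obtain U V a where "a \<noteq> 0" "U * h + V * f = of_int a"
    using irreducible_monic_dvd_or_bezout[OF f(1,2)] by blast
  hence "ieval \<theta> (U * h + V * f) = of_int a" by simp
  thus False using \<open>a \<noteq> 0\<close> f(3) h by simp
qed

section \<open>Denominators in Q(theta) and integral bases\<close>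

lemma ieval_mem_rat_adjoin: "ieval \<theta> h \<in> rat_adjoin \<theta>"
proof (induction h)
  case 0
  show ?case using rat_adjoin.of_rat[of 0] by simp
next
  case (pCons c h)
  have "of_rat (of_int c) + \<theta> * ieval \<theta> h \<in> rat_adjoin \<theta>"
    by (intro rat_adjoin.intros pCons)
  also have "of_rat (of_int c) + \<theta> * ieval \<theta> h = ieval \<theta> (pCons c h)"
    by (simp add: ieval_def of_int_hom.map_poly_pCons_hom)
  finally show ?case .
qed

text \<open>Induction on the generation of the field. For an inverse, evaluating U h + V f = a at
  theta gives a = n U(theta) x, so \<open>a\<close> is a denominator of 1/x.\<close>

lemma rat_adjoin_clear_denominator:
  assumes f: "lead_coeff f = 1" "irreducible (map_poly of_int f :: rat poly)" "ieval \<theta> f = 0"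
    and x: "x \<in> rat_adjoin \<theta>"
  obtains n h where "n > (0::nat)" "of_nat n * x = ieval \<theta> h"
proof -
  have "\<exists>n\<noteq>(0::int). \<exists>h. of_int n * x = ieval \<theta> h"
    using x
  proof induction
    case (of_rat q)
    obtain n d where q: "q = of_int n / of_int d" "d > 0"
      using quotient_of_div[of q] quotient_of_denom_pos[of q] by (metis prod.exhaust)
    have "of_int d * of_rat q = ieval \<theta> (of_int n)"
      using q by (simp add: of_rat_divide)
    thus ?case using q(2) by (metis less_irrefl)
  next
    case gen
    have "of_int 1 * \<theta> = ieval \<theta> (monom 1 1)" by simp
    thus ?case using one_neq_zero by blast
  next
    case (add x y)
    then obtain n h n' h' where "n \<noteq> 0" "of_int n * x = ieval \<theta> h" "n' \<noteq> 0" "of_int n' * y = ieval \<theta> h'"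
      by blast
    hence "of_int (n * n') * (x + y) = ieval \<theta> (of_int n' * h + of_int n * h')" "n * n' \<noteq> 0"
      by (simp_all flip: \<open>of_int n * x = _\<close> \<open>of_int n' * y = _\<close> add: algebra_simps)
    thus ?case by blast
  next
    case (uminus x)
    then obtain n h where "n \<noteq> 0" "of_int n * x = ieval \<theta> h" by blast
    hence "of_int n * (- x) = ieval \<theta> (- h)" by simp
    thus ?case using \<open>n \<noteq> 0\<close> by blast
  next
    case (mult x y)
    then obtain n h n' h' where "n \<noteq> 0" "of_int n * x = ieval \<theta> h" "n' \<noteq> 0" "of_int n' * y = ieval \<theta> h'"
      by blast
    hence "of_int (n * n') * (x * y) = ieval \<theta> (h * h')" "n * n' \<noteq> 0"
      by (simp_all flip: \<open>of_int n * x = _\<close> \<open>of_int n' * y = _\<close> add: algebra_simps)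
    thus ?case by blast
  next
    case (inverse x)
    then obtain n h where nh: "n \<noteq> 0" "of_int n * x = ieval \<theta> h" by blast
    show ?case
    proof (cases "x = 0")
      case True
      \<comment> \<open>The convention \<open>inverse 0 = 0\<close> applies.\<close>
      have "of_int 1 * Fields.inverse x = ieval \<theta> 0" using True by simp
      thus ?thesis using one_neq_zero by blast
    next
      case False
      hence "\<not> f dvd h" using nh f(3) by (auto elim!: dvdE)
      then obtain U V a where a: "a \<noteq> 0" "U * h + V * f = of_int a"
        using irreducible_monic_dvd_or_bezout[OF f(1,2)] by blast
      have "of_int a = ieval \<theta> U * ieval \<theta> h"
        using arg_cong[OF a(2), of "ieval \<theta>"] f(3) by simp
      also have "\<dots> = of_int n * ieval \<theta> U * x" by (simp flip: nh(2))
      finally have "of_int a = of_int n * ieval \<theta> U * x" .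
      hence "of_int a * Fields.inverse x = ieval \<theta> (of_int n * U)"
        using False by simp
      thus ?thesis using a(1) by blast
    qed
  qed
  then obtain n h where nh: "n \<noteq> 0" "of_int n * x = ieval \<theta> h" by blast
  \<comment> \<open>The sign moves into the numerator; a positive natural denominator suits the
    induction in \<open>integral_imp_ieval\<close>.\<close>
  have "of_nat (nat \<bar>n\<bar>) * x = ieval \<theta> (of_int (sgn n) * h)"
    by (simp flip: nh(2) add: abs_if sgn_if)
  thus ?thesis using that[of "nat \<bar>n\<bar>" "of_int (sgn n) * h"] nh(1) by simp
qed

lemma ieval_low_degree_eq_0:
  fixes \<theta> :: complex
  assumes f: "lead_coeff f = 1" "irreducible (map_poly of_int f :: rat poly)" "ieval \<theta> f = 0"
    and h: "ieval \<theta> h = 0" "degree h < degree f"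
  shows "h = 0"
  using ieval_eq_0_imp_dvd[OF f h(1)] h(2) dvd_imp_degree_le by (metis leD)

lemma ieval_low_degree_repr:
  assumes f: "lead_coeff f = 1" "ieval \<theta> f = 0" "degree f > 0"
  obtains r where "ieval \<theta> h = ieval \<theta> r" "degree r < degree f"
proof -
  obtain q r where qr: "h = f * q + r" "r = 0 \<or> degree r < degree f"
    using monic_division[OF f(1)] .
  thus ?thesis using that[of r] f by auto
qed

text \<open>Division by \<open>f\<close> shows that the powers span Z[theta], irreducibility makes
  them independent, and Z[theta] is integral. What remains is the inclusion of the ring of integers
  in Z[theta].\<close>

lemma int_basis_powers_iff:
  fixes \<theta> :: complex
  assumes f: "lead_coeff f = 1" "irreducible (map_poly of_int f :: rat poly)" "ieval \<theta> f = 0"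
  shows "int_basis ((\<lambda>i. \<theta> ^ i) ` {..<degree f}) (ring_of_integers (rat_adjoin \<theta>)) \<longleftrightarrow>
    (\<forall>z \<in> rat_adjoin \<theta>. algebraic_int z \<longrightarrow> z \<in> range (ieval \<theta>))"
proof -
  let ?B = "(\<lambda>i. \<theta> ^ i) ` {..<degree f}"
  have df: "degree f > 0"
  proof (rule ccontr)
    assume "\<not> degree f > 0"
    hence "f = 1" using f(1) by (metis degree_0_id one_poly_eq_simps(1) neq0_conv)
    thus False using f(3) by simp
  qed
  have \<theta>: "algebraic_int \<theta>" using f by (auto simp: algebraic_int_altdef_ipoly ieval_def)
  have inj: "inj_on (\<lambda>i. \<theta> ^ i) {..<degree f}"
  proof (rule inj_onI)
    fix i j assume ij: "i \<in> {..<degree f}" "j \<in> {..<degree f}" "\<theta> ^ i = \<theta> ^ j"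
    have "monom 1 i - monom 1 j = (0 :: int poly)"
      using ij by (intro ieval_low_degree_eq_0[OF f]) (auto intro!: degree_diff_less simp: degree_monom_eq)
    thus "i = j" by (simp add: monom_eq_iff')
  qed
  have span: "int_module.span ?B = range (ieval \<theta>)"
  proof (intro equalityI subsetI)
    fix z assume "z \<in> int_module.span ?B"
    thus "z \<in> range (ieval \<theta>)"
    proof (induction rule: int_module.span_induct_alt)
      case base
      show ?case by (rule range_eqI[of _ _ 0]) simp
    next
      case (step c x y)
      then obtain i h where "x = \<theta> ^ i" "y = ieval \<theta> h" by auto
      thus ?case by (intro range_eqI[of _ _ "monom c i + h"]) (simp add: int_scale_def)
    qed
  next
    fix z assume "z \<in> range (ieval \<theta>)"
    then obtain r where r: "z = ieval \<theta> r" "degree r < degree f"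
      using ieval_low_degree_repr[OF f(1,3) df] by (metis imageE)
    have "z = (\<Sum>i\<le>degree r. int_scale (coeff r i) (\<theta> ^ i))"
      by (simp add: r(1) ieval_def poly_altdef int_scale_def)
    also have "\<dots> \<in> int_module.span ?B"
      using r(2) by (intro int_module.span_sum int_module.span_scale int_module.span_base) auto
    finally show "z \<in> int_module.span ?B" .
  qed
  have indep: "int_module.independent ?B"
  proof
    assume "int_module.dependent ?B"
    then obtain u v where u: "v \<in> ?B" "u v \<noteq> 0" "(\<Sum>v\<in>?B. int_scale (u v) v) = 0"
      by (subst (asm) int_module.dependent_finite) auto
    \<comment> \<open>A dependence among the powers, read as coefficients, is a polynomial of degree
      below that of \<open>f\<close> vanishing at theta.\<close>
    define h where "h = (\<Sum>i<degree f. monom (u (\<theta> ^ i)) i)"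
    have "ieval \<theta> h = (\<Sum>v\<in>?B. int_scale (u v) v)"
      by (subst sum.reindex[OF inj]) (simp add: h_def int_scale_def)
    hence "h = 0"
      using u(3) df unfolding h_def
      by (intro ieval_low_degree_eq_0[OF f]) (auto intro!: degree_sum_less order.strict_trans1[OF degree_monom_le])
    obtain i where i: "i < degree f" "v = \<theta> ^ i" using u(1) by auto
    have "coeff h i = u (\<theta> ^ i)" using i(1) by (simp add: h_def coeff_sum)
    thus False using \<open>h = 0\<close> u(2) i(2) by simp
  qed
  have "range (ieval \<theta>) \<subseteq> ring_of_integers (rat_adjoin \<theta>)"
    using ieval_mem_rat_adjoin[of \<theta>] algebraic_int_poly[OF \<theta>] by (auto simp: ring_of_integers_def ieval_def)
  thus ?thesis using indep span by (auto simp: int_basis_def ring_of_integers_def)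
qed

text \<open>Maximality can be tested one prime at a time: if n = p n', then n' z is an integral
  element with denominator \<open>p\<close>, so n' is already a denominator of
  \<open>z\<close>.\<close>

lemma integral_imp_ieval:
  assumes f: "lead_coeff f = 1" "irreducible (map_poly of_int f :: rat poly)" "ieval \<theta> f = 0"
    and max: "\<And>p h. prime (p::nat) \<Longrightarrow> algebraic_int (ieval \<theta> h / of_nat p) \<Longrightarrow>
      ieval \<theta> h / of_nat p \<in> range (ieval \<theta>)"
    and z: "z \<in> rat_adjoin \<theta>" "algebraic_int z"
  shows "z \<in> range (ieval \<theta>)"
proof -
  obtain n h where "n > (0::nat)" "of_nat n * z = ieval \<theta> h"
    using rat_adjoin_clear_denominator[OF f z(1)] .
  thus ?thesis
  proof (induction n arbitrary: h rule: less_induct)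
    case (less n)
    show ?case
    proof (cases "n = 1")
      case True
      thus ?thesis using less.prems by auto
    next
      case False
      then obtain p where p: "prime p" "p dvd n" using prime_factor_nat by blast
      then obtain n' where n': "n = p * n'" by blast
      have p0: "p > 1" using p prime_gt_1_nat by blast
      have eq: "ieval \<theta> h / of_nat p = of_nat n' * z"
        using p0 less.prems(2) by (simp add: n' field_simps)
      have "algebraic_int (of_nat n' * z)" using z(2) by (intro algebraic_int_mult) auto
      hence "of_nat n' * z \<in> range (ieval \<theta>)" using max[OF p(1), of h] eq by simp
      then obtain h' where "of_nat n' * z = ieval \<theta> h'" by auto
      moreover have "n' > 0" "n' < n" using less.prems(1) n' p0 by auto
      ultimately show ?thesis using less.IH by blast
    qed
  qed
qed

subsection \<open>Monogenicity of the trinomial\<close>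

lemma degree_lead_coeff_trinomial_F2:
  assumes "k \<ge> 1"
  shows "degree (trinomial_F2 b m k) = 2 * k" "lead_coeff (trinomial_F2 b m k) = 1"
proof -
  let ?r = "monom (b * m\<^sup>2) k + [:b:]"
  have "degree ?r \<le> k" by (intro degree_add_le degree_monom_le) simp
  hence "degree ?r < degree (monom (1::int) (2 * k))" using assms by (simp add: degree_monom_eq)
  moreover have "trinomial_F2 b m k = monom 1 (2 * k) + ?r" by (simp add: trinomial_F2_def add.assoc)
  ultimately show d: "degree (trinomial_F2 b m k) = 2 * k"
    by (simp only: degree_add_eq_left degree_monom_eq one_neq_zero not_False_eq_True)
  show "lead_coeff (trinomial_F2 b m k) = 1"
    unfolding d using assms by (simp add: trinomial_F2_def coeff_pCons split: nat.splits)
qed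

lemma squarefree_imp_not_square_dvd:
  "squarefree (b :: int) \<Longrightarrow> prime p \<Longrightarrow> \<not> p\<^sup>2 dvd b"
  using not_prime_unit by (auto simp: squarefree_def)

lemma irreducible_trinomial_F2:
  assumes b: "b \<ge> 2" "squarefree b" and k: "k \<ge> 1"
  shows "irreducible (map_poly of_int (trinomial_F2 b m k) :: rat poly)"
proof -
  obtain p where p: "prime p" "p dvd b" using prime_divisor_exists[of b] b(1) by auto
  show ?thesis
  proof (rule eisenstein_irreducible[OF p(1)])
    fix i assume "i < degree (trinomial_F2 b m k)"
    hence "i < 2 * k" by (simp add: degree_lead_coeff_trinomial_F2[OF k])
    thus "p dvd coeff (trinomial_F2 b m k) i"
      using p(2) by (auto simp: trinomial_F2_def coeff_pCons split: nat.splits)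
  next
    have "coeff (trinomial_F2 b m k) 0 = b" using k by (simp add: trinomial_F2_def)
    thus "\<not> p\<^sup>2 dvd coeff (trinomial_F2 b m k) 0"
      using squarefree_imp_not_square_dvd[OF b(2) p(1)] by simp
  qed (use degree_lead_coeff_trinomial_F2[OF k] k in auto)
qed

text \<open>The quantity D equals 4 - b m^4, and the part divided out to obtain
  \<open>d_part\<close> is prime to \<open>p\<close>; hence p^2 would survive in the squarefree
  \<open>d_part\<close>.\<close>

lemma not_square_dvd_disc_factor:
  fixes b m :: int
  assumes m: "\<bar>m\<bar> \<ge> 2" and b: "b \<ge> 2" and sf: "squarefree (d_part 2 b m)"
    and p: "prime p" and nb: "\<not> p dvd b" and nm: "\<not> p dvd m"
  shows "\<not> p\<^sup>2 dvd 4 - b * m ^ 4"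
proof
  define D where "D = D_quot 2 b m"
  have "D_num 2 b m = D_den 2 b m * (4 - b * m ^ 4)"
    unfolding D_num_def D_den_def
    by (simp add: algebra_simps power2_eq_square power3_eq_cube power_numeral_reduce)
  hence D: "D = 4 - b * m ^ 4" using D_den_nonzero[of b m] by (simp add: D_def D_quot_def)
  assume "p\<^sup>2 dvd 4 - b * m ^ 4"
  hence pD: "p\<^sup>2 dvd \<bar>D\<bar>" by (simp add: D)
  have "2 ^ 4 \<le> \<bar>m\<bar> ^ 4" using m by (intro power_mono) auto
  hence "16 \<le> m ^ 4" by simp
  hence "2 * 16 \<le> b * m ^ 4" using b by (intro mult_mono) auto
  hence D0: "D \<noteq> 0" using D by simp
  define Q where "Q = (\<Prod>q\<in>prime_factors (b * m). q ^ multiplicity q D)"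
  have "(\<Prod>q\<in>S. q ^ multiplicity q D) dvd D" if "finite S" "\<And>q. q \<in> S \<Longrightarrow> prime q" for S :: "int set"
    using that
  proof (induction S rule: finite_induct)
    case (insert q S)
    have "coprime (q ^ multiplicity q D) (\<Prod>r\<in>S. r ^ multiplicity r D)"
    proof (rule prod_coprime_right)
      fix r assume "r \<in> S"
      hence "coprime q r" using insert by (intro primes_coprime) auto
      thus "coprime (q ^ multiplicity q D) (r ^ multiplicity r D)" by simp
    qed
    thus ?case using insert by (simp add: divides_mult multiplicity_dvd)
  qed simp
  hence "Q dvd \<bar>D\<bar>" unfolding Q_def by auto
  hence "d_part 2 b m * Q = \<bar>D\<bar>" by (simp add: d_part_def Q_def D_def)
  hence "p\<^sup>2 dvd d_part 2 b m * Q" using pD by simp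
  moreover have "coprime (p\<^sup>2) Q" unfolding Q_def
  proof (rule prod_coprime_right)
    fix q assume q: "q \<in> prime_factors (b * m)"
    hence "p \<noteq> q" using nb nm p by (auto simp: in_prime_factors_iff prime_dvd_mult_iff)
    hence "coprime p q" using p q by (intro primes_coprime) auto
    thus "coprime (p\<^sup>2) (q ^ multiplicity q D)" by simp
  qed
  ultimately have "p\<^sup>2 dvd d_part 2 b m" by (simp add: coprime_dvd_mult_left_iff)
  thus False using squarefree_imp_not_square_dvd[OF sf p] by simp
qed

text \<open>If the quotient were r(theta) with \<open>r\<close> of degree below that of
  \<open>f\<close>, then h - p r would vanish at theta, hence be zero, and \<open>p\<close> would
  divide a monic polynomial.\<close>

lemma monic_low_degree_not_divisible:
  fixes \<theta> :: complex
  assumes f: "lead_coeff f = 1" "irreducible (map_poly of_int f :: rat poly)" "ieval \<theta> f = 0"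
    and h: "lead_coeff h = 1" "degree h < degree f" and p: "prime (p::int)"
  shows "ieval \<theta> h / of_int p \<notin> range (ieval \<theta>)"
proof
  assume "ieval \<theta> h / of_int p \<in> range (ieval \<theta>)"
  then obtain r where r: "ieval \<theta> h / of_int p = ieval \<theta> r" "degree r < degree f"
    using ieval_low_degree_repr[OF f(1,3)] h(2) by (metis imageE gr_implies_not0 neq0_conv)
  have "p \<noteq> 0" using p by auto
  have "h - of_int p * r = 0"
  proof (rule ieval_low_degree_eq_0[OF f])
    show "ieval \<theta> (h - of_int p * r) = 0" using r(1) \<open>p \<noteq> 0\<close> by (simp add: field_simps)
    show "degree (h - of_int p * r) < degree f"
      using h(2) r(2) \<open>p \<noteq> 0\<close> by (intro degree_diff_less) (auto simp: of_int_poly)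
  qed
  hence "of_int p dvd h" by simp
  hence "p dvd 1" using h(1) by (metis of_int_dvd_poly_iff)
  thus False using p by auto
qed

text \<open>Substituting theta^k = 2 z - 1, m = 2 m1 and b = 4 t - 1 makes the equation of theta
  divisible by 4, which leaves a monic quadratic for \<open>z\<close>.\<close>

lemma half_integral:
  fixes \<theta> :: complex
  assumes \<theta>: "ieval \<theta> (trinomial_F2 b m k) = 0" "algebraic_int \<theta>" and "even m" "4 dvd b + 1"
  shows "algebraic_int (ieval \<theta> (monom 1 k + 1) / of_int 2)"
proof -
  obtain m1 t where m1: "m = 2 * m1" and t: "b = 4 * t - 1"
    using assms(3,4) by (metis add_diff_cancel_right' dvdE)
  define z where "z = ieval \<theta> (monom 1 k + 1) / of_int 2"
  have "\<theta> ^ k = 2 * z - 1" by (simp add: z_def)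
  hence "(2 * z - 1)\<^sup>2 + of_int (b * m\<^sup>2) * (2 * z - 1) + of_int b = 0"
    using \<theta>(1) by (simp add: trinomial_F2_eq)
  hence "4 * z\<^sup>2 = 4 * (of_int (1 - 2 * b * m1\<^sup>2) * z + of_int (b * m1\<^sup>2 - t))"
    unfolding m1 t by (simp add: algebra_simps power2_eq_square)
  hence "z\<^sup>2 = of_int (1 - 2 * b * m1\<^sup>2) * z + of_int (b * m1\<^sup>2 - t)"
    by (subst (asm) mult_cancel_left) simp
  hence "z\<^sup>2 = ieval \<theta> (of_int (1 - 2 * b * m1\<^sup>2)) * z + ieval \<theta> (of_int (b * m1\<^sup>2 - t))"
    by simp
  thus ?thesis
    unfolding z_def[symmetric] by (intro algebraic_int_quadratic[OF \<theta>(2)]) (simp only: ieval_def)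
qed

text \<open>With \<open>W = x ^ (2 k / p)\<close>, the quotient \<open>S = (W ^ p - (-b) ^ p) / (W + b)\<close> is congruent to
  \<open>(W + b) ^ (p - 1)\<close> modulo \<open>p\<close>, while \<open>(W + b) S\<close> vanishes modulo \<open>p\<^sup>2\<close> at \<open>\<theta>\<close>; hence
  \<open>S(\<theta>) / p\<close> is a root of a monic quadratic polynomial over \<open>\<int>[\<theta>]\<close>.\<close>

lemma wieferich_integral:
  fixes \<theta> :: complex
  assumes \<theta>: "ieval \<theta> (trinomial_F2 b m k) = 0" "algebraic_int \<theta>"
    and p: "prime p" "odd p" and k: "k \<ge> 1" "p dvd k" and m: "int p dvd m"
    and b: "(int p)\<^sup>2 dvd b ^ p - b"
  obtains S where "lead_coeff S = 1" "degree S < 2 * k" "algebraic_int (ieval \<theta> S / of_int (int p))"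
proof -
  obtain k1 where k1: "k = p * k1" using k(2) by blast
  have k1_pos: "k1 > 0" using k(1) k1 by (cases k1) auto
  have p3: "p \<ge> 3" using p prime_ge_2_nat[OF p(1)] by (cases "p = 2") auto
  obtain m1 where m1: "m = int p * m1" using m by blast
  obtain t where t: "b ^ p = b + (int p)\<^sup>2 * t" using b by (metis dvdE diff_add_cancel add.commute)
  define W :: "int poly" where "W = monom 1 (2 * k1)"
  define c :: "int poly" where "c = - of_int b"
  have WP: "W ^ p = monom 1 (2 * k)" by (simp add: W_def monom_power k1 mult_ac)
  have cp: "c ^ p = - of_int (b ^ p)" using p(2) by (simp add: c_def)
  define S where "S = (\<Sum>i<p. c ^ (p - Suc i) * W ^ i)"
  have S: "(W - c) * S = W ^ p - c ^ p" unfolding S_def by (rule power_diff_sumr2[symmetric])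
  have Wc: "degree (W - c) = 2 * k1" "lead_coeff (W - c) = 1"
  proof -
    have "degree (of_int b :: int poly) < degree W" using k1_pos by (simp add: W_def degree_monom_eq)
    thus d: "degree (W - c) = 2 * k1" by (simp add: c_def degree_add_eq_left) (simp add: W_def degree_monom_eq)
    show "lead_coeff (W - c) = 1"
      unfolding d using k1_pos by (simp add: W_def c_def of_int_poly coeff_pCons split: nat.splits)
  qed
  have Wcp: "degree (W ^ p - c ^ p) = 2 * k" "lead_coeff (W ^ p - c ^ p) = 1"
  proof -
    have "degree (of_int (b ^ p) :: int poly) < degree (monom (1::int) (2 * k))"
      using k(1) by (simp only: degree_of_int degree_monom_eq)
    thus d: "degree (W ^ p - c ^ p) = 2 * k"
      by (simp only: WP cp diff_minus_eq_add degree_add_eq_left) (simp add: degree_monom_eq)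
    show "lead_coeff (W ^ p - c ^ p) = 1"
      unfolding d using k(1) by (simp add: WP cp of_int_poly coeff_pCons split: nat.splits flip: of_int_power)
  qed
  have nz: "S \<noteq> 0" "W - c \<noteq> 0" using S Wcp(2) Wc(2) by auto
  have dS: "degree S < 2 * k"
    using degree_mult_eq[OF nz(2,1)] k1_pos by (simp only: S Wcp Wc)
  have lS: "lead_coeff S = 1"
    using lead_coeff_mult[of "W - c" S] Wcp(2)[unfolded Wcp(1)] Wc(2)[unfolded Wc(1)]
    by (simp only: S Wcp(1) Wc(1) mult_1)
  have "of_nat p dvd (W - c) ^ p - (W ^ p - c ^ p)"
    using prime_dvd_power_add_diff[OF p(1), of W "- c"] p(2) by simp
  \<comment> \<open>The monic factor W - c can be cancelled modulo \<open>p\<close>, since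
    \<open>p\<close> is prime in Z[x].\<close>
  also have "(W - c) ^ p - (W ^ p - c ^ p) = (W - c) * ((W - c) ^ (p - 1) - S)"
    using p3 by (simp flip: S power_Suc add: right_diff_distrib)
  finally have "of_int (int p) dvd (W - c) * ((W - c) ^ (p - 1) - S)" by simp
  moreover have "\<not> int p dvd lead_coeff (W - c)" using Wc(2) p3 by simp
  hence "\<not> of_int (int p) dvd W - c" by (metis of_int_dvd_poly_iff)
  ultimately have "of_int (int p) dvd (W - c) ^ (p - 1) - S"
    using prime_elem_of_int_poly[of "int p"] p(1) prime_elem_dvd_mult_iff by auto
  then obtain u where u: "(W - c) ^ (p - 1) - S = of_int (int p) * u" by blast
  \<comment> \<open>The value of (W - c) S at theta divided by p^2, found from theta^(2k) = -b - b
    m^2 theta^k and b^p = b + p^2 t.\<close>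
  define \<gamma> :: "int poly" where "\<gamma> = of_int t - of_int (b * m1\<^sup>2) * monom 1 k"
  define z where "z = ieval \<theta> S / of_int (int p)"
  have Sz: "ieval \<theta> S = of_nat p * z" using p3 by (simp add: z_def)
  have root: "\<theta> ^ (2 * k) = - of_int b - of_int (b * m\<^sup>2) * \<theta> ^ k"
    using \<theta>(1) by (simp add: trinomial_F2_def algebra_simps eq_neg_iff_add_eq_0 flip: power_mult)
  have "ieval \<theta> (W - c) * ieval \<theta> S = \<theta> ^ (2 * k) + of_int (b ^ p)"
    unfolding ieval_simps(7)[symmetric] S WP cp by simp
  also have "\<dots> = (of_nat p)\<^sup>2 * ieval \<theta> \<gamma>"
    unfolding root t by (simp add: \<gamma>_def m1 algebra_simps power2_eq_square)
  finally have \<gamma>: "ieval \<theta> (W - c) * z = of_nat p * ieval \<theta> \<gamma>"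
    using p3 by (simp add: Sz power2_eq_square)
  have "S = (W - c) ^ (p - 1) - of_int (int p) * u" unfolding u[symmetric] by simp
  \<comment> \<open>One factor W - c is split off so that, multiplied by \<open>z\<close>, it
    becomes p times the value of \<open>\<gamma>\<close>.\<close>
  also have "p - 1 = Suc (p - 2)" using p3 by simp
  also note power_Suc2
  finally have "S = (W - c) ^ (p - 2) * (W - c) - of_int (int p) * u" .
  hence "of_nat p * z = ieval \<theta> ((W - c) ^ (p - 2)) * ieval \<theta> (W - c) - of_nat p * ieval \<theta> u"
    by (simp flip: Sz)
  hence "of_nat p * z * z = ieval \<theta> ((W - c) ^ (p - 2)) * (ieval \<theta> (W - c) * z) - of_nat p * ieval \<theta> u * z"
    by (simp only: left_diff_distrib mult.assoc)
  also have "\<dots> = of_nat p * (ieval \<theta> (- u) * z + ieval \<theta> ((W - c) ^ (p - 2) * \<gamma>))"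
    unfolding \<gamma> by (simp add: algebra_simps)
  finally have "z\<^sup>2 = ieval \<theta> (- u) * z + ieval \<theta> ((W - c) ^ (p - 2) * \<gamma>)"
    using p3 by (simp only: mult.assoc power2_eq_square mult_cancel_left) auto
  hence "algebraic_int z"
    by (intro algebraic_int_quadratic[OF \<theta>(2)]) (simp only: ieval_def)
  thus ?thesis using that lS dS by (simp add: z_def)
qed

theorem theorem1p2:
  fixes m b :: int and k :: nat
  assumes "\<bar>m\<bar> \<ge> 2" and "b \<ge> 2" and "k \<ge> 1"
    and "gcd b m = 1"
    and "squarefree b"
    and "[m = 0] (mod rad (int k))"
    and "squarefree (d_part 2 b m)"
  shows "monogenic (trinomial_F2 b m k) \<longleftrightarrow>
           (\<forall>p::nat. prime p \<and> odd p \<and> p dvd k \<longrightarrow> \<not> wieferich_prime b p) \<and>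
           ([m = 0] (mod 2) \<longrightarrow> [b = 1] (mod 4))"
proof -
  let ?f = "trinomial_F2 b m k"
  note f = degree_lead_coeff_trinomial_F2(2)[OF assms(3)] irreducible_trinomial_F2[OF assms(2,5,3)]
  have monogenic_iff: "monogenic ?f \<longleftrightarrow>
    (\<forall>\<theta>::complex. ieval \<theta> ?f = 0 \<longrightarrow> (\<forall>z \<in> rat_adjoin \<theta>. algebraic_int z \<longrightarrow> z \<in> range (ieval \<theta>)))"
    unfolding monogenic_def using f int_basis_powers_iff[OF f] by (simp add: ieval_def[symmetric])
  have rad: "int p dvd m" if "prime p" "p dvd k" for p
  proof -
    have "int p \<in> prime_factors (int k)" using that assms(3) by (auto simp: in_prime_factors_iff)
    hence "int p dvd rad (int k)" unfolding rad_def by (intro dvd_prodI) auto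
    thus ?thesis using assms(6) by (auto simp: cong_0_iff)
  qed
  have cop: "\<not> int p dvd b" if "prime p" "int p dvd m" for p
    using that assms(4) by (metis gcd_greatest not_prime_unit prime_nat_int_transfer)
  have wieferich_iff: "wieferich_prime b p \<longleftrightarrow> (int p)\<^sup>2 dvd b ^ p - b" if "prime p" "p dvd k" for p
  proof -
    \<comment> \<open>Since \<open>p\<close> divides \<open>m\<close>, it is prime to
      \<open>b\<close>, and the factor \<open>b\<close> can be cancelled modulo p^2.\<close>
    have "b ^ p - b = b * (b ^ (p - 1) - 1)"
      using prime_gt_0_nat[OF that(1)] by (simp add: right_diff_distrib flip: power_Suc)
    moreover have "coprime ((int p)\<^sup>2) b"
      using cop[OF that(1) rad[OF that]] that(1) by (simp add: prime_imp_coprime)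
    ultimately show ?thesis
      using that(1) by (simp add: wieferich_prime_def cong_iff_dvd_diff coprime_dvd_mult_right_iff)
  qed
  \<comment> \<open>For even \<open>m\<close>, coprimality makes \<open>b\<close> odd, hence 1 or -1
    modulo 4.\<close>
  have mod4: "[b = 1] (mod 4) \<longleftrightarrow> \<not> 4 dvd b + 1" if "even m"
  proof -
    have "odd b" using cop[of 2] that by simp
    thus ?thesis unfolding cong_def by presburger
  qed
  show ?thesis
  proof
    assume "monogenic ?f"
    hence max: "z \<in> range (ieval \<theta>)" if "ieval \<theta> ?f = 0" "z \<in> rat_adjoin \<theta>" "algebraic_int z"
      for \<theta> z :: complex using monogenic_iff that by blast
    \<comment> \<open>\<open>monogenic\<close> quantifies over all complex roots, so using it
      requires that a root exists.\<close>
    have "\<not> constant (poly (map_poly of_int ?f :: complex poly))"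
      using assms(3) by (simp add: constant_degree degree_lead_coeff_trinomial_F2)
    then obtain \<theta> :: complex where \<theta>: "ieval \<theta> ?f = 0"
      using fundamental_theorem_of_algebra unfolding ieval_def by blast
    have alg: "algebraic_int \<theta>" using f(1) \<theta> by (auto simp: algebraic_int_altdef_ipoly ieval_def)
    have no_integral: "\<not> algebraic_int (ieval \<theta> h / of_int p)"
      if h: "lead_coeff h = 1" "degree h < 2 * k" and p: "prime (p::int)" for h p
    proof
      assume "algebraic_int (ieval \<theta> h / of_int p)"
      moreover have "ieval \<theta> h * of_rat (inverse (of_int p)) \<in> rat_adjoin \<theta>"
        by (intro rat_adjoin.mult rat_adjoin.of_rat ieval_mem_rat_adjoin)
      hence "ieval \<theta> h / of_int p \<in> rat_adjoin \<theta>" by (simp add: of_rat_inverse divide_inverse)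
      ultimately have "ieval \<theta> h / of_int p \<in> range (ieval \<theta>)" using max[OF \<theta>] by blast
      thus False
        using monic_low_degree_not_divisible[OF f \<theta> h(1) _ p] h(2)
        by (simp add: degree_lead_coeff_trinomial_F2[OF assms(3)])
    qed
    have "\<not> wieferich_prime b p" if p: "prime p" "odd p" "p dvd k" for p
    proof
      assume "wieferich_prime b p"
      hence "(int p)\<^sup>2 dvd b ^ p - b" using wieferich_iff p by blast
      from wieferich_integral[OF \<theta> alg p(1,2) assms(3) p(3) rad[OF p(1,3)] this]
      show False using no_integral p(1) by (metis prime_nat_int_transfer)
    qed
    moreover have "[b = 1] (mod 4)" if "[m = 0] (mod 2)"
    proof (rule ccontr)
      assume nb: "\<not> [b = 1] (mod 4)"
      have m: "even m" using that by (simp add: cong_0_iff)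
      have d: "degree (monom 1 k + 1 :: int poly) = k"
        using assms(3) by (subst degree_add_eq_left) (auto simp: degree_monom_eq)
      have "lead_coeff (monom 1 k + 1 :: int poly) = 1"
        unfolding d using assms(3) by simp
      thus False
        using half_integral[OF \<theta> alg m] no_integral[of "monom 1 k + 1" 2] nb m mod4 d assms(3) by simp
    qed
    ultimately show "(\<forall>p::nat. prime p \<and> odd p \<and> p dvd k \<longrightarrow> \<not> wieferich_prime b p) \<and>
        ([m = 0] (mod 2) \<longrightarrow> [b = 1] (mod 4))" by blast
  next
    assume cond: "(\<forall>p::nat. prime p \<and> odd p \<and> p dvd k \<longrightarrow> \<not> wieferich_prime b p) \<and>
        ([m = 0] (mod 2) \<longrightarrow> [b = 1] (mod 4))"
    have "z \<in> range (ieval \<theta>)"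
      if \<theta>: "ieval \<theta> ?f = 0" and z: "z \<in> rat_adjoin \<theta>" "algebraic_int z" for \<theta> z :: complex
    proof (rule integral_imp_ieval[OF f \<theta> _ z])
      fix p :: nat and h
      assume p: "prime p" and h: "algebraic_int (ieval \<theta> h / of_nat p)"
      show "ieval \<theta> h / of_nat p \<in> range (ieval \<theta>)"
      proof (rule ccontr)
        assume nin: "ieval \<theta> h / of_nat p \<notin> range (ieval \<theta>)"
        have pi: "prime (int p)" using p by simp
        obtain g where g: "prime_pmod (int p) g" "?f \<in> pmod_ideal_sq (int p) g"
          using not_maximal_imp_mem_square[OF f(1) \<theta> ieval_eq_0_imp_dvd[OF f \<theta>] pi, of h] h nin
          by auto
        have "?f \<notin> pmod_ideal_sq (int p) g"
        proof (rule trinomial_F2_not_mem_square[OF assms(3) _ p g(1)])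
          show "b \<ge> 0" using assms(2) by simp
          show "\<not> (int p)\<^sup>2 dvd b" using squarefree_imp_not_square_dvd assms(5) pi by blast
          show "int p dvd m" if "p dvd k" using rad p that by blast
          show "\<not> 4 dvd b + 1" if "even m" using cond mod4 that by (simp add: cong_0_iff)
          show "\<not> (int p)\<^sup>2 dvd b ^ p - b" if "odd p" "p dvd k"
            using cond wieferich_iff p that by blast
          show "\<not> (int p)\<^sup>2 dvd 4 - b * m ^ 4" if "\<not> int p dvd b" "\<not> int p dvd m"
            using not_square_dvd_disc_factor[OF assms(1,2,7) pi that] .
        qed
        thus False using g(2) by blast
      qed
    qed
    thus "monogenic ?f" using monogenic_iff by blast
  qed
qed

end
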